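(* Let $G$ be a finite multistage game with observed actions, pruned with respect to the default strategy profile, and let $f:\Theta\to X$ be a social choice function. The game $G$ implements $f$ (under leakages) if and only if $G$ admits a leakage-proof equilibrium that implements $f$.
   Context: **Primitives.** $N=\{1,\dots,n\}$ is the set of players; $\Theta_i$ is the finite set of payoff types of $i$, $\Theta=\times_{i\in N}\Theta_i$; payoff types are independent with common prior $\rho(\theta)=\prod_i\rho_i(\theta_i)$. $X$ is a finite set of outcomes and $u_i:X\times\Theta\to\mathbb R$ are von Neumann–Morgenstern utilities. The payoff structure is common knowledge. **Game.** A finite multistage game with observed actions is $G=\{H,\subset,P,(A_i)_{i\in N},g\}$. $H$ is a finite set of public histories $h^{k-1}=(a^1,\dots,a^{k-1})$ (before stage $k$), containing the empty history $h_\emptyset$ and closed under initial segments; $\subset$ is the precedence relation. At each nonterminal $h^{k-1}$ the players in $P(h^{k-1})\subseteq N$ move simultaneously, each choosing $a_i^k$ from a feasible set $A_i(h^{k-1})$ with at least two elements; the other players have no move ($a_i^k=\emptyset$). Every combination of feasible actions gives a history $h^k=h^{k-1}\|a^k\in H$ ($\|$ is concatenation), and public histories are disclosed at the start of each stage. $Z$ is the set of terminal histories and $g(z)\in X$ is the outcome at $z\in Z$; write $u_i(z,\theta)=u_i(g(z),\theta)$. **Leakage orders.** A leakage order is a complete and transitive binary relation $\precsim$ on $N$, with strict part $\prec$ and symmetric part $\sim$; $\mathcal L$ is the set of all leakage orders. If $i\prec j$ ($j$ is faster than $i$), then $j$ observes $i$'s concurrent action whenever both move at a stage, but not the other way round;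 if $i\sim j$ (equally fast), neither sees the other's concurrent action. Under $\precsim$, player $i$'s private history at stage $k$ after public history $h^{k-1}$ is $h_i^{k-1}=h^{k-1}\|\{a_j^k\}_{j\prec i}$. The set of leakage orders consistent with $\precsim$ from $i$'s viewpoint is $E_i(\precsim)=\{\precsim'\in\mathcal L: j\prec i\iff j\prec' i,\ \forall j\}$. **Leakage type spaces.** $\mathcal T=\{T,(\tau_1,\dots,\tau_n)\}$ with $T=T_1\times\dots\times T_n$, each $T_i$ a finite set of leakage types, and $\tau_i:T_i\to\Delta(\mathcal L\times T_{-i})$; $\gamma_{-i}=\mathrm{marg}_{T_{-i}}\tau_i(t_i)$ is the prior of type $t_i$ on the others' leakage types. A type space is feasible (admissible) if it satisfies the following two assumptions. *Consistency of first-order beliefs:* if the leakage order is $\precsim\in\mathcal L$, then for every $t_i\in T_i$, $\mathrm{supp}(\mathrm{marg}_{\mathcal L}\tau_i(t_i))\subseteq E_i(\precsim)$. (Higher-order beliefs may be wrong.) *Minimal richness:* $\mathcal T$ contains the zero-profile $t^0=(t_1^0,\dots,t_n^0)$, where $t_i^0$ is the belief "it is common knowledge that everyone is equally fast", and all $n$ one-profiles $(t_1^0,\dots,t_{i-1}^0,t_i^1,t_{i+1}^0,\dots,t_n^0)$, where $t_i^1$ is the belief "I am faster than everyone else, who all believe it is common knowledge that everyone is equally fast". The order in which everyone is equally fast is the unique order consistent with the zero-profile, and the order in which exactly one player is faster than all others (who are equally fast) is the unique order consistent with the corresponding one-profile; so situations with at least these $n+1$ leakage orders are considered. **Strategies and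 beliefs.** The leakage environment is $\Gamma=(G,\mathcal T)$. $H_i(t_i)$ is the set of private histories of player $i$ with leakage type $t_i$. A strategy prescribes $S_i(\theta_i,t_i)(h_i^{k-1})\in\Delta A_i(h^{k-1})$ for each $(\theta_i,t_i)$ and each private history $h_i^{k-1}$, where $h^{k-1}$ is the public history preceding $h_i^{k-1}$; $\Sigma_i(t_i)$ is the set of strategies available to leakage type $t_i$. Beliefs are $\mu_i(h_i^{k-1},t_i)\in\Delta(\Theta_{-i}\times T_{-i})$, with initial belief $\prod_{j\ne i}\rho_j\times\gamma_{-i}$. For a profile $\sigma$ of contingent action plans, $\zeta(\sigma)$ is the induced distribution on $Z$ and $U_i(\sigma,\theta)=\sum_{z\in Z}u_i(z,\theta)\zeta(\sigma)(z)$. **PBE.** $(S,\mu)$ is a perfect Bayesian equilibrium (PBE) of $\Gamma=(G,\mathcal T)$ if (1) for all $i\in N$, all $(\theta_i,t_i)\in\Theta_i\times T_i$, all stages $k$ and all $h_i^{k-1}\in H_i(t_i)$, $S_i(\theta_i,t_i)\in\arg\max_{\sigma_i\in\Sigma_i(t_i)}\mathbb E_{\mu_i}[U_i(\sigma_i,(S_j(\theta_j,t_j))_{j\ne i},\theta_i,\theta_{-i})\mid h_i^{k-1},t_i]$; and (2) beliefs are updated by Bayes' rule whenever possible (arbitrary off the path of play). **Default game and pruning.** $G$ itself, without leakage, is the default game; a PBE $(S^0,\mu^0)$ of $G$, with strategies $S_i^0(\theta_i)(h)\in\Delta A_i(h)$, is called the default PBE. $G$ is assumed pruned with respect to the default strategy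 profile $S^0$: for each $h\in H$ there is a payoff type profile $\theta$ such that $h$ is on the path of play of some realization of $(S_j^0(\theta_j))_{j\in N}$. **Leakage-proof equilibrium.** $(S^0,\mu^0)$ is a leakage-proof equilibrium in $G$ if for each feasible leakage type space $\mathcal T$ the environment $(G,\mathcal T)$ admits a PBE $(S,\mu)$ such that for all $\theta\in\Theta$ and $t\in T$, all $i\in N$, and all private histories $h_i^{k-1}\in H_i(t_i)$ that are on the path of play of $S^0$, $S_i(\theta_i,t_i)(h_i^{k-1})=S_i^0(\theta_i)(h^{k-1})$. It implements $f$ if it yields the outcome $f(\theta)$ for all $\theta\in\Theta$. **Implementation under leakages.** $G$ implements $f$ if for each feasible leakage type space $\mathcal T$ the environment $(G,\mathcal T)$ admits a PBE $(S,\mu)$ yielding outcome $f(\theta)$ for all $\theta\in\Theta$ and all $t\in T$.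
   Formalization: Added: if G implements f, the default strategy profile is the zero-profile part of some PBE yielding f in a feasible leakage type space (otherwise false). The prior has full support; first-order consistency is read state by state; f is required at leakage profiles with a consistent order. *)

theory Defs
  imports "HOL-Probability.Product_PMF"
begin

text \<open>
  The players are the elements of a finite type \<open>'i\<close>.  Profiles over all players are functions on
  \<open>'i\<close>; profiles over all players but \<open>i\<close> are elements of \<^term>\<open>PiE (- {i})\<close> (undefined at \<open>i\<close>), and
  \<open>q(i := x)\<close> completes such a profile.
\<close>

section \<open>Payoff structure\<close>

record ('i, 'q, 'x) payoffs =
  payoff_types :: "'i \<Rightarrow> 'q set"
  prior :: "'i \<Rightarrow> 'q pmf"
  outcomes :: "'x set"
  utility :: "'i \<Rightarrow> 'x \<Rightarrow> ('i \<Rightarrow> 'q) \<Rightarrow> real"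

definition payoff_profiles :: "('i, 'q, 'x) payoffs \<Rightarrow> ('i \<Rightarrow> 'q) set" where
  "payoff_profiles M = {\<theta>. \<forall>i. \<theta> i \<in> payoff_types M i}"

definition valid_payoffs :: "('i, 'q, 'x) payoffs \<Rightarrow> bool" where
  "valid_payoffs M \<longleftrightarrow>
     (\<forall>i. finite (payoff_types M i) \<and> set_pmf (prior M i) = payoff_types M i) \<and>
     finite (outcomes M)"

section \<open>Multistage games with observed actions\<close>

text \<open>
  A stage is a partial map from players to actions; it is undefined at the players who have no move.
  A public history is the list of past stages, the oldest one first.
\<close>

type_synonym ('i, 'a) history = "('i \<rightharpoonup> 'a) list"

record ('i, 'a, 'x) game =
  histories :: "('i, 'a) history set"
  movers :: "('i, 'a) history \<Rightarrow> 'i set"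
  actions :: "'i \<Rightarrow> ('i, 'a) history \<Rightarrow> 'a set"
  outcome :: "('i, 'a) history \<Rightarrow> 'x"

definition terminal :: "('i, 'a, 'x) game \<Rightarrow> ('i, 'a) history \<Rightarrow> bool" where
  "terminal G h \<longleftrightarrow> h \<in> histories G \<and> (\<nexists>a. h @ [a] \<in> histories G)"

definition multistage_game :: "('i, 'q, 'x) payoffs \<Rightarrow> ('i, 'a, 'x) game \<Rightarrow> bool" where
  "multistage_game M G \<longleftrightarrow>
     finite (histories G) \<and> [] \<in> histories G \<and>
     (\<forall>h a. h @ [a] \<in> histories G \<longrightarrow> h \<in> histories G) \<and>
     (\<forall>h \<in> histories G. \<not> terminal G h \<longrightarrow>
        (\<forall>i \<in> movers G h. finite (actions G i h) \<and> 2 \<le> card (actions G i h)) \<and>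
        {a. h @ [a] \<in> histories G} =
          {a. dom a = movers G h \<and> (\<forall>i \<in> movers G h. the (a i) \<in> actions G i h)}) \<and>
     (\<forall>z. terminal G z \<longrightarrow> outcome G z \<in> outcomes M)"

section \<open>Leakage orders and leakage type spaces\<close>

text \<open>\<open>(i, j) \<in> r\<close> means that \<open>j\<close> is at least as fast as \<open>i\<close>.\<close>

definition leakage_orders :: "'i rel set" where
  "leakage_orders = {r. trans r \<and> (\<forall>i j. (i, j) \<in> r \<or> (j, i) \<in> r)}"

definition slower :: "'i rel \<Rightarrow> 'i \<Rightarrow> 'i set" where
  "slower r i = {j. (j, i) \<in> r \<and> (i, j) \<notin> r}"

definition consistent_orders :: "'i \<Rightarrow> 'i rel \<Rightarrow> 'i rel set" where
  "consistent_orders i r = {r' \<in> leakage_orders. \<forall>j. j \<in> slower r i \<longleftrightarrow> j \<in> slower r' i}"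

definition all_equal :: "'i rel" where
  "all_equal = UNIV"

definition fastest :: "'i \<Rightarrow> 'i rel" where
  "fastest i = {(j, k). k = i \<or> j \<noteq> i}"

record ('i, 't) type_space =
  leakage_types :: "'i \<Rightarrow> 't set"
  type_belief :: "'i \<Rightarrow> 't \<Rightarrow> ('i rel \<times> ('i \<Rightarrow> 't)) pmf"

definition leakage_profiles :: "('i, 't) type_space \<Rightarrow> ('i \<Rightarrow> 't) set" where
  "leakage_profiles T = {t. \<forall>i. t i \<in> leakage_types T i}"

definition possible_orders :: "('i, 't) type_space \<Rightarrow> 'i \<Rightarrow> 't \<Rightarrow> 'i rel set" where
  "possible_orders T i ti = set_pmf (map_pmf fst (type_belief T i ti))"

definition consistent :: "('i, 't) type_space \<Rightarrow> 'i rel \<Rightarrow> ('i \<Rightarrow> 't) \<Rightarrow> bool" where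
  "consistent T r t \<longleftrightarrow>
     r \<in> leakage_orders \<and> (\<forall>i. possible_orders T i (t i) \<subseteq> consistent_orders i r)"

text \<open>
  Since \<^term>\<open>leakage_types T\<close> are combined freely, a profile may contain, say, two types each of
  which is certain of being strictly faster than everyone else.  No leakage order is consistent with
  such a profile, and it does not describe a situation that can occur.
\<close>

definition realizable :: "('i, 't) type_space \<Rightarrow> ('i \<Rightarrow> 't) \<Rightarrow> bool" where
  "realizable T t \<longleftrightarrow> (\<exists>r. consistent T r t)"

definition zero_profile :: "('i, 't) type_space \<Rightarrow> ('i \<Rightarrow> 't) \<Rightarrow> bool" where
  "zero_profile T t0 \<longleftrightarrow>
     t0 \<in> leakage_profiles T \<and>
     (\<forall>i. type_belief T i (t0 i) = return_pmf (all_equal, restrict t0 (- {i})))"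

text \<open>
  The profile \<open>t0\<close> is the zero-profile of the type space, which also contains the one-profiles
  \<^term>\<open>t0(i := ti)\<close>.
\<close>

definition minimally_rich :: "('i, 't) type_space \<Rightarrow> ('i \<Rightarrow> 't) \<Rightarrow> bool" where
  "minimally_rich T t0 \<longleftrightarrow>
     zero_profile T t0 \<and>
     (\<forall>i. \<exists>ti \<in> leakage_types T i.
        type_belief T i ti = return_pmf (fastest i, restrict t0 (- {i})))"

definition feasible :: "('i, 't) type_space \<Rightarrow> bool" where
  "feasible T \<longleftrightarrow>
     (\<forall>i. finite (leakage_types T i)) \<and>
     (\<forall>i. \<forall>ti \<in> leakage_types T i.
        set_pmf (type_belief T i ti) \<subseteq> leakage_orders \<times> PiE (- {i}) (leakage_types T) \<and>
        (\<forall>(r, t) \<in> set_pmf (type_belief T i ti). consistent T r (t(i := ti)))) \<and>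
     (\<exists>t0. minimally_rich T t0)"

text \<open>
  The players that are slower than \<open>i\<close> according to the type \<open>ti\<close>.  In a feasible type space all
  orders in \<^term>\<open>possible_orders T i ti\<close> agree on them, and at a realizable profile they are the
  slower players of the actual order.
\<close>

definition observed :: "('i, 't) type_space \<Rightarrow> 'i \<Rightarrow> 't \<Rightarrow> 'i set" where
  "observed T i ti = (\<Union>r \<in> possible_orders T i ti. slower r i)"

section \<open>Private histories, plays and strategies\<close>

text \<open>
  A private history is a public history with the concurrent actions that have leaked; concurrent
  actions leak only to players who move themselves.  Below, \<open>D\<close> is the set of players slower than
  \<open>i\<close>, or the family of these sets.
\<close>

type_synonym ('i, 'a) private_history = "('i, 'a) history \<times> ('i \<rightharpoonup> 'a)"

definition leaked :: "('i, 'a, 'x) game \<Rightarrow> 'i \<Rightarrow> 'i set \<Rightarrow> ('i, 'a) history \<Rightarrow> 'i set" where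
  "leaked G i D h = (if i \<in> movers G h then D else {})"

definition private_histories ::
  "('i, 'a, 'x) game \<Rightarrow> 'i \<Rightarrow> 'i set \<Rightarrow> ('i, 'a) private_history set" where
  "private_histories G i D = {(h, a |` leaked G i D h) | h a. h @ [a] \<in> histories G}"

definition plans ::
  "('i, 'a, 'x) game \<Rightarrow> 'i \<Rightarrow> 'i set \<Rightarrow> (('i, 'a) private_history \<Rightarrow> 'a pmf) set" where
  "plans G i D =
     {\<sigma>. \<forall>(h, l) \<in> private_histories G i D. i \<in> movers G h \<longrightarrow> set_pmf (\<sigma> (h, l)) \<subseteq> actions G i h}"

text \<open>
  The probability that the players in \<open>J\<close>, all of them movers at \<open>h\<close>, act as in the stage \<open>a\<close>, given
  the actions in \<open>a\<close> that they observe.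
\<close>

definition stage_prob ::
  "('i \<Rightarrow> 'i set) \<Rightarrow> ('i \<Rightarrow> ('i, 'a) private_history \<Rightarrow> 'a pmf) \<Rightarrow>
   'i set \<Rightarrow> ('i, 'a) history \<Rightarrow> ('i \<rightharpoonup> 'a) \<Rightarrow> real" where
  "stage_prob D \<sigma> J h a = (\<Prod>j\<in>J. pmf (\<sigma> j (h, a |` D j)) (the (a j)))"

definition reach_prob ::
  "('i, 'a, 'x) game \<Rightarrow> ('i \<Rightarrow> 'i set) \<Rightarrow> ('i \<Rightarrow> ('i, 'a) private_history \<Rightarrow> 'a pmf) \<Rightarrow>
   ('i, 'a) history \<Rightarrow> real" where
  "reach_prob G D \<sigma> h =
     (\<Prod>k<length h. stage_prob D \<sigma> (movers G (take k h)) (take k h) (h ! k))"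

text \<open>
  The probability of the terminal history \<open>z\<close> conditional on the private history \<open>(h, l)\<close> of \<open>i\<close>: the
  public history \<open>h\<close> and the leaked actions \<open>l\<close> are given, and the remaining movers at \<open>h\<close> as well as
  all movers at later stages follow \<open>\<sigma>\<close>.
\<close>

definition cont_prob ::
  "('i, 'a, 'x) game \<Rightarrow> ('i \<Rightarrow> 'i set) \<Rightarrow> ('i \<Rightarrow> ('i, 'a) private_history \<Rightarrow> 'a pmf) \<Rightarrow> 'i \<Rightarrow>
   ('i, 'a) private_history \<Rightarrow> ('i, 'a) history \<Rightarrow> real" where
  "cont_prob G D \<sigma> i = (\<lambda>(h, l) z.
     if length h < length z \<and> take (length h) z = h \<and>
        (z ! length h) |` leaked G i (D i) h = l
     then stage_prob D \<sigma> (movers G h - leaked G i (D i) h) h (z ! length h) *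
          (\<Prod>k\<in>{Suc (length h)..<length z}.
             stage_prob D \<sigma> (movers G (take k z)) (take k z) (z ! k))
     else 0)"

definition cont_utility ::
  "('i, 'q, 'x) payoffs \<Rightarrow> ('i, 'a, 'x) game \<Rightarrow> ('i \<Rightarrow> 'i set) \<Rightarrow>
   ('i \<Rightarrow> ('i, 'a) private_history \<Rightarrow> 'a pmf) \<Rightarrow> ('i \<Rightarrow> 'q) \<Rightarrow> 'i \<Rightarrow> ('i, 'a) private_history \<Rightarrow> real"
  where
  "cont_utility M G D \<sigma> \<theta> i hi =
     (\<Sum>z | terminal G z. utility M i (outcome G z) \<theta> * cont_prob G D \<sigma> i hi z)"

type_synonym ('i, 'q, 't, 'a) strategies =
  "'i \<Rightarrow> 'q \<Rightarrow> 't \<Rightarrow> ('i, 'a) private_history \<Rightarrow> 'a pmf"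

type_synonym ('i, 'q, 't, 'a) beliefs =
  "'i \<Rightarrow> ('i, 'a) private_history \<Rightarrow> 't \<Rightarrow> (('i \<Rightarrow> 'q) \<times> ('i \<Rightarrow> 't)) pmf"

section \<open>Perfect Bayesian equilibrium of a leakage environment\<close>

definition observed_profile :: "('i, 't) type_space \<Rightarrow> ('i \<Rightarrow> 't) \<Rightarrow> 'i \<Rightarrow> 'i set" where
  "observed_profile T t = (\<lambda>j. observed T j (t j))"

definition expected_utility ::
  "('i, 'q, 'x) payoffs \<Rightarrow> ('i, 'a, 'x) game \<Rightarrow> ('i, 't) type_space \<Rightarrow>
   ('i, 'q, 't, 'a) strategies \<Rightarrow> ('i, 'q, 't, 'a) beliefs \<Rightarrow>
   'i \<Rightarrow> 'q \<Rightarrow> 't \<Rightarrow> ('i, 'a) private_history \<Rightarrow> (('i, 'a) private_history \<Rightarrow> 'a pmf) \<Rightarrow> real" where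
  "expected_utility M G T S \<mu> i \<theta>i ti hi \<sigma>i =
     measure_pmf.expectation (\<mu> i hi ti) (\<lambda>(\<theta>, t).
       cont_utility M G (observed_profile T (t(i := ti)))
         ((\<lambda>j. S j (\<theta> j) (t j))(i := \<sigma>i)) (\<theta>(i := \<theta>i)) i hi)"

definition initial_belief ::
  "('i::finite, 'q, 'x) payoffs \<Rightarrow> ('i, 't) type_space \<Rightarrow> 'i \<Rightarrow> 't \<Rightarrow>
   (('i \<Rightarrow> 'q) \<times> ('i \<Rightarrow> 't)) pmf" where
  "initial_belief M T i ti =
     pair_pmf (Pi_pmf (- {i}) undefined (prior M)) (map_pmf snd (type_belief T i ti))"

text \<open>
  The probability of the other players' moves recorded in the private history \<open>(h, l)\<close> of \<open>i\<close>.  The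
  moves of \<open>i\<close> itself contribute a factor that does not depend on the other players' types, hence
  cancels in Bayes' rule; leaving it out makes Bayes' rule apply after deviations of \<open>i\<close> itself too.
\<close>

definition likelihood ::
  "('i, 'a, 'x) game \<Rightarrow> ('i \<Rightarrow> 'i set) \<Rightarrow> ('i \<Rightarrow> ('i, 'a) private_history \<Rightarrow> 'a pmf) \<Rightarrow> 'i \<Rightarrow>
   ('i, 'a) private_history \<Rightarrow> real" where
  "likelihood G D \<sigma> i = (\<lambda>(h, l).
     (\<Prod>k<length h. stage_prob D \<sigma> (movers G (take k h) - {i}) (take k h) (h ! k)) *
     stage_prob D \<sigma> (movers G h \<inter> leaked G i (D i) h) h l)"

definition bayes_consistent ::
  "('i::finite, 'q, 'x) payoffs \<Rightarrow> ('i, 'a, 'x) game \<Rightarrow> ('i, 't) type_space \<Rightarrow>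
   ('i, 'q, 't, 'a) strategies \<Rightarrow> ('i, 'q, 't, 'a) beliefs \<Rightarrow>
   'i \<Rightarrow> 't \<Rightarrow> ('i, 'a) private_history \<Rightarrow> bool" where
  "bayes_consistent M G T S \<mu> i ti hi \<longleftrightarrow>
     (let lik = (\<lambda>(\<theta>, t). likelihood G (observed_profile T (t(i := ti)))
                   (\<lambda>j. S j (\<theta> j) (t j)) i hi);
          total = measure_pmf.expectation (initial_belief M T i ti) lik
      in total > 0 \<longrightarrow>
         (\<forall>x. pmf (\<mu> i hi ti) x = pmf (initial_belief M T i ti) x * lik x / total))"

definition PBE ::
  "('i::finite, 'q, 'x) payoffs \<Rightarrow> ('i, 'a, 'x) game \<Rightarrow> ('i, 't) type_space \<Rightarrow>
   ('i, 'q, 't, 'a) strategies \<Rightarrow> ('i, 'q, 't, 'a) beliefs \<Rightarrow> bool" where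
  "PBE M G T S \<mu> \<longleftrightarrow>
     (\<forall>i. \<forall>ti \<in> leakage_types T i. \<forall>hi \<in> private_histories G i (observed T i ti).
        (\<forall>\<theta>i \<in> payoff_types M i.
           is_arg_max (expected_utility M G T S \<mu> i \<theta>i ti hi)
             (\<lambda>\<sigma>i. \<sigma>i \<in> plans G i (observed T i ti)) (S i \<theta>i ti)) \<and>
        set_pmf (\<mu> i hi ti) \<subseteq>
          PiE (- {i}) (payoff_types M) \<times>
          {t \<in> PiE (- {i}) (leakage_types T). realizable T (t(i := ti))} \<and>
        bayes_consistent M G T S \<mu> i ti hi)"

definition yields ::
  "('i, 'q, 'x) payoffs \<Rightarrow> ('i, 'a, 'x) game \<Rightarrow> ('i, 't) type_space \<Rightarrow>
   ('i, 'q, 't, 'a) strategies \<Rightarrow> (('i \<Rightarrow> 'q) \<Rightarrow> 'x) \<Rightarrow> bool" where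
  "yields M G T S f \<longleftrightarrow>
     (\<forall>\<theta> \<in> payoff_profiles M. \<forall>t \<in> leakage_profiles T. realizable T t \<longrightarrow>
        (\<forall>z. terminal G z \<and> reach_prob G (observed_profile T t) (\<lambda>j. S j (\<theta> j) (t j)) z > 0 \<longrightarrow>
           outcome G z = f \<theta>))"

text \<open>
  Every finite type space is isomorphic to one whose types are natural numbers.
\<close>

definition implements ::
  "('i::finite, 'q, 'x) payoffs \<Rightarrow> ('i, 'a, 'x) game \<Rightarrow> (('i \<Rightarrow> 'q) \<Rightarrow> 'x) \<Rightarrow> bool" where
  "implements M G f \<longleftrightarrow>
     (\<forall>T :: ('i, nat) type_space. feasible T \<longrightarrow> (\<exists>S \<mu>. PBE M G T S \<mu> \<and> yields M G T S f))"

section \<open>The default game and leakage-proof equilibria\<close>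

text \<open>
  The game without leakage is the environment in which it is common knowledge that everyone is
  equally fast, every player having a single leakage type; nothing ever leaks in it.
\<close>

definition no_leakage :: "('i, unit) type_space" where
  "no_leakage = \<lparr> leakage_types = (\<lambda>_. UNIV),
                  type_belief = (\<lambda>_ _. return_pmf (all_equal, \<lambda>_. ())) \<rparr>"

type_synonym ('i, 'q, 'a) default_strategies = "'i \<Rightarrow> 'q \<Rightarrow> ('i, 'a) history \<Rightarrow> 'a pmf"

type_synonym ('i, 'q, 'a) default_beliefs = "'i \<Rightarrow> ('i, 'a) history \<Rightarrow> ('i \<Rightarrow> 'q) pmf"

definition lift_strategies ::
  "('i, 'q, 'a) default_strategies \<Rightarrow> ('i, 'q, unit, 'a) strategies" where
  "lift_strategies S0 = (\<lambda>i \<theta>i _ (h, _). S0 i \<theta>i h)"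

definition lift_beliefs ::
  "('i, 'q, 'a) default_beliefs \<Rightarrow> ('i, 'q, unit, 'a) beliefs" where
  "lift_beliefs \<mu>0 = (\<lambda>i (h, _) _. map_pmf (\<lambda>\<theta>. (\<theta>, \<lambda>_. ())) (\<mu>0 i h))"

definition default_PBE ::
  "('i::finite, 'q, 'x) payoffs \<Rightarrow> ('i, 'a, 'x) game \<Rightarrow>
   ('i, 'q, 'a) default_strategies \<Rightarrow> ('i, 'q, 'a) default_beliefs \<Rightarrow> bool" where
  "default_PBE M G S0 \<mu>0 \<longleftrightarrow> PBE M G no_leakage (lift_strategies S0) (lift_beliefs \<mu>0)"

definition default_yields ::
  "('i, 'q, 'x) payoffs \<Rightarrow> ('i, 'a, 'x) game \<Rightarrow>
   ('i, 'q, 'a) default_strategies \<Rightarrow> (('i \<Rightarrow> 'q) \<Rightarrow> 'x) \<Rightarrow> bool" where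
  "default_yields M G S0 f \<longleftrightarrow> yields M G no_leakage (lift_strategies S0) f"

definition on_path ::
  "('i, 'a, 'x) game \<Rightarrow> ('i, 'q, 'a) default_strategies \<Rightarrow> ('i \<Rightarrow> 'q) \<Rightarrow>
   ('i, 'a) history \<Rightarrow> bool" where
  "on_path G S0 \<theta> h \<longleftrightarrow>
     h \<in> histories G \<and> reach_prob G (\<lambda>_. {}) (\<lambda>j (h, _). S0 j (\<theta> j) h) h > 0"

definition pruned ::
  "('i, 'q, 'x) payoffs \<Rightarrow> ('i, 'a, 'x) game \<Rightarrow> ('i, 'q, 'a) default_strategies \<Rightarrow> bool" where
  "pruned M G S0 \<longleftrightarrow> (\<forall>h \<in> histories G. \<exists>\<theta> \<in> payoff_profiles M. on_path G S0 \<theta> h)"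

definition private_on_path ::
  "('i, 'a, 'x) game \<Rightarrow> ('i, 'q, 'a) default_strategies \<Rightarrow> ('i \<Rightarrow> 'q) \<Rightarrow> 'i \<Rightarrow> 'i set \<Rightarrow>
   ('i, 'a) private_history \<Rightarrow> bool" where
  "private_on_path G S0 \<theta> i D = (\<lambda>(h, l).
     \<exists>a. on_path G S0 \<theta> (h @ [a]) \<and> l = a |` leaked G i D h)"

definition leakage_proof ::
  "('i::finite, 'q, 'x) payoffs \<Rightarrow> ('i, 'a, 'x) game \<Rightarrow>
   ('i, 'q, 'a) default_strategies \<Rightarrow> ('i, 'q, 'a) default_beliefs \<Rightarrow> bool" where
  "leakage_proof M G S0 \<mu>0 \<longleftrightarrow>
     default_PBE M G S0 \<mu>0 \<and>
     (\<forall>T :: ('i, nat) type_space. feasible T \<longrightarrow>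
        (\<exists>S \<mu>. PBE M G T S \<mu> \<and>
           (\<forall>\<theta> \<in> payoff_profiles M. \<forall>t \<in> leakage_profiles T. \<forall>i.
              \<forall>(h, l) \<in> private_histories G i (observed T i (t i)).
                private_on_path G S0 \<theta> i (observed T i (t i)) (h, l) \<and> i \<in> movers G h \<longrightarrow>
                S i (\<theta> i) (t i) (h, l) = S0 i (\<theta> i) h)))"

text \<open>
  \<open>S0\<close> is what the strategies \<open>S\<close> prescribe to the types in the zero-profile, that is, when it is
  common knowledge that nothing leaks.  To these types nothing leaks, so their private histories are
  of the form \<open>(h, Map.empty)\<close>.
\<close>

definition default_part ::
  "('i, 'q, 'x) payoffs \<Rightarrow> ('i, 'a, 'x) game \<Rightarrow> ('i, 't) type_space \<Rightarrow>
   ('i, 'q, 't, 'a) strategies \<Rightarrow> ('i, 'q, 'a) default_strategies \<Rightarrow> bool" where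
  "default_part M G T S S0 \<longleftrightarrow>
     (\<exists>t0. minimally_rich T t0 \<and>
        (\<forall>i. \<forall>\<theta>i \<in> payoff_types M i. \<forall>h \<in> histories G.
           \<not> terminal G h \<and> i \<in> movers G h \<longrightarrow> S0 i \<theta>i h = S i \<theta>i (t0 i) (h, Map.empty)))"

end

theory Submission
  imports Defs
begin

text \<open>
  Fix a player \<open>i\<close> and suppose that the others play the default strategies as long as their own past
  moves follow them.  Pruning makes every private history of \<open>i\<close> reachable without a zero-probability
  move of the others, so Bayes' rule applies everywhere, and the expected utility of a plan at a
  private history is, up to a positive factor, a sum over the terminal histories of a weight that
  does not depend on the leakage types, times the probability of \<open>i\<close>'s own moves.

  Suppose that \<open>G\<close> implements \<open>f\<close>.  In the one-profile of \<open>i\<close> the player \<open>i\<close> observes all concurrent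
  moves of the others, who play the default strategies.  The outcome is \<open>f(\<theta>)\<close> there, and so it is if
  \<open>i\<close> plays the default strategy itself; hence the default strategy is optimal even under full
  observation.  A profitable deviation at some history that follows the default strategy could be
  spliced into it, so it is optimal there too, whatever \<open>i\<close> observes.  At the histories where \<open>i\<close> has
  deviated before, an optimal plan is found by backward induction; this never affects the others'
  likelihoods.

  Conversely, under a leakage-proof equilibrium every play stays on the path of the default
  strategies: within a stage this is seen by going from the slower players to the faster ones.
\<close>

section \<open>Products, expectations and stages\<close>

text \<open>If some factor of the second product vanishes for \<open>j\<close>, take the first
  \<open>k\<close> at which this happens: the hypothesis makes \<open>F\<close> vanish there too, so
  both products are \<open>0\<close>. Thus two strategies can be exchanged in a probability of play
  even if they agree only as long as the player's own earlier moves have positive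
  probability.\<close>

lemma prod_eq_until_zero:
  fixes F F' :: "nat \<Rightarrow> 'i \<Rightarrow> real"
  assumes fin: "finite K" "\<And>k. k \<in> K \<Longrightarrow> finite (J k)"
    and eq: "\<And>k j. \<lbrakk>k \<in> K; j \<in> J k; \<And>l. l \<in> K \<Longrightarrow> l < k \<Longrightarrow> j \<in> J l \<Longrightarrow> F' l j \<noteq> 0\<rbrakk> \<Longrightarrow> F k j = F' k j"
  shows "(\<Prod>k\<in>K. \<Prod>j\<in>J k. F k j) = (\<Prod>k\<in>K. \<Prod>j\<in>J k. F' k j)"
proof (cases "\<forall>k\<in>K. \<forall>j\<in>J k. F' k j \<noteq> 0")
  case True
  then show ?thesis
    by (intro prod.cong refl eq) auto
next
  case False
  then obtain k0 j where "k0 \<in> K" "j \<in> J k0" "F' k0 j = 0"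
    by blast
  define k where "k = (LEAST k. k \<in> K \<and> j \<in> J k \<and> F' k j = 0)"
  have k: "k \<in> K" "j \<in> J k" "F' k j = 0"
    using LeastI[of "\<lambda>k. k \<in> K \<and> j \<in> J k \<and> F' k j = 0" k0] \<open>k0 \<in> K\<close> \<open>j \<in> J k0\<close> \<open>F' k0 j = 0\<close>
    unfolding k_def by auto
  have "F k j = F' k j"
    using k not_less_Least[of _ "\<lambda>k. k \<in> K \<and> j \<in> J k \<and> F' k j = 0"]
    by (intro eq) (auto simp: k_def[symmetric])
  then have "(\<Prod>j\<in>J k. F k j) = 0" "(\<Prod>j\<in>J k. F' k j) = 0"
    using k fin by (auto intro!: prod_zero)
  then show ?thesis
    using k(1) fin(1) by (metis (no_types, lifting) prod_zero)
qed

lemma finite_support_expectation: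
  fixes F :: "'b \<Rightarrow> real"
  assumes "finite A" "set_pmf p \<subseteq> A"
  shows "measure_pmf.expectation p F = (\<Sum>x\<in>A. pmf p x * F x)"
  using assms by (subst integral_measure_pmf_real[of A]) (auto simp: mult.commute)

text \<open>The set of movers is a parameter, so that sums over joint moves can be computed by
  induction on it and the moves of the others separated from that of \<open>i\<close>.\<close>

definition stage_maps :: "'i set \<Rightarrow> ('i \<Rightarrow> 'a set) \<Rightarrow> ('i \<rightharpoonup> 'a) set" where
  "stage_maps J A = {a. dom a = J \<and> (\<forall>i\<in>J. the (a i) \<in> A i)}"

text \<open>A joint move is a pair of the others' moves and an action of \<open>i\<close>. The
  summand sees the former as the restriction to \<open>- {i}\<close> because that is what
  \<open>i\<close> observes when everybody else is slower.\<close>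

lemma sum_stage_maps_insert:
  fixes F :: "('i \<rightharpoonup> 'a) \<Rightarrow> 'a \<Rightarrow> real"
  assumes "i \<notin> J"
  shows "(\<Sum>b\<in>stage_maps (insert i J) A. F (b |` (- {i})) (the (b i))) =
         (\<Sum>a\<in>stage_maps J A. \<Sum>x\<in>A i. F a x)"
proof -
  have "(\<Sum>(a, x)\<in>stage_maps J A \<times> A i. F a x) =
        (\<Sum>b\<in>stage_maps (insert i J) A. F (b |` (- {i})) (the (b i)))"
  proof (rule sum.reindex_bij_witness[where j = "\<lambda>(a, x). a(i \<mapsto> x)" and i = "\<lambda>b. (b |` (- {i}), the (b i))"])
    fix ax assume ax: "ax \<in> stage_maps J A \<times> A i"
    obtain a x where [simp]: "ax = (a, x)" by force
    have a: "dom a = J" "\<forall>i\<in>J. the (a i) \<in> A i" "x \<in> A i"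
      using ax by (auto simp: stage_maps_def)
    have *: "a |` (- {i}) = a"
      using a(1) assms by (auto simp: restrict_map_def fun_eq_iff)
    show "(\<lambda>b. (b |` (- {i}), the (b i))) ((\<lambda>(a, x). a(i \<mapsto> x)) ax) = ax"
      using * by simp
    show "(\<lambda>(a, x). a(i \<mapsto> x)) ax \<in> stage_maps (insert i J) A"
      using a by (auto simp: stage_maps_def)
    show "F (((\<lambda>(a, x). a(i \<mapsto> x)) ax) |` (- {i})) (the (((\<lambda>(a, x). a(i \<mapsto> x)) ax) i)) = (\<lambda>(a, x). F a x) ax"
      using * by simp
  next
    fix b assume b: "b \<in> stage_maps (insert i J) A"
    show "(\<lambda>(a, x). a(i \<mapsto> x)) (b |` (- {i}), the (b i)) = b"
      using b by (auto simp: stage_maps_def fun_eq_iff restrict_map_def domIff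
          intro!: option.collapse)
    show "(b |` (- {i}), the (b i)) \<in> stage_maps J A \<times> A i"
      using b assms by (auto simp: stage_maps_def restrict_map_def split: if_splits)
  qed
  then show ?thesis
    by (simp add: sum.cartesian_product)
qed

lemma sum_stage_maps_prod_pmf:
  assumes "finite J" "\<And>j. j \<in> J \<Longrightarrow> finite (A j) \<and> set_pmf (p j) \<subseteq> A j"
  shows "(\<Sum>a\<in>stage_maps J A. \<Prod>j\<in>J. pmf (p j) (the (a j))) = 1"
  using assms
proof (induction J rule: finite_induct)
  case empty
  have "stage_maps {} A = {Map.empty}"
    by (auto simp: stage_maps_def)
  then show ?case by simp
next
  case (insert i J)
  have "(\<Sum>b\<in>stage_maps (insert i J) A. \<Prod>j\<in>insert i J. pmf (p j) (the (b j))) =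
        (\<Sum>b\<in>stage_maps (insert i J) A.
           (\<Prod>j\<in>J. pmf (p j) (the ((b |` (- {i})) j))) * pmf (p i) (the (b i)))"
    using insert.hyps by (intro sum.cong refl) (auto intro!: prod.cong simp: restrict_map_def)
  also have "\<dots> = (\<Sum>a\<in>stage_maps J A. \<Sum>x\<in>A i. (\<Prod>j\<in>J. pmf (p j) (the (a j))) * pmf (p i) x)"
    by (rule sum_stage_maps_insert) fact
  also have "\<dots> = 1"
    using insert by (simp add: sum_distrib_left[symmetric] sum_pmf_eq_1)
  finally show ?case .
qed

section \<open>Play against the default strategies\<close>

lemma mem_private_histories:
  "(h, l) \<in> private_histories G i D \<longleftrightarrow> (\<exists>a. h @ [a] \<in> histories G \<and> l = a |` leaked G i D h)"
  by (auto simp: private_histories_def)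

lemma observed_irrefl: "i \<notin> observed T i ti"
  by (auto simp: observed_def slower_def)

lemma stage_prob_split:
  fixes i :: "'i::finite"
  shows "stage_prob D \<sigma> J h a = stage_prob D \<sigma> (J - {i}) h a * stage_prob D \<sigma> (J \<inter> {i}) h a"
proof -
  have "J = (J - {i}) \<union> (J \<inter> {i})" by auto
  then show ?thesis
    unfolding stage_prob_def by (subst prod.union_disjoint[symmetric]) auto
qed

text \<open>Of the default strategies only feasibility is assumed. Optimality enters later as a
  hypothesis on ex ante values, so the locale can be instantiated with any default PBE.\<close>

locale default_play =
  fixes M :: "('i::finite, 'q, 'x) payoffs"
    and G :: "('i, 'a, 'x) game"
    and S0 :: "('i, 'q, 'a) default_strategies"
  assumes valid: "valid_payoffs M"
    and multistage: "multistage_game M G"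
    and S0_actions: "\<lbrakk>\<theta>i \<in> payoff_types M i; h @ [a] \<in> histories G; i \<in> movers G h\<rbrakk> \<Longrightarrow>
           set_pmf (S0 i \<theta>i h) \<subseteq> actions G i h"
begin

section \<open>Histories and feasible actions\<close>

lemma finite_histories: "finite (histories G)"
  using multistage by (simp add: multistage_game_def)

lemma Nil_history: "[] \<in> histories G"
  using multistage by (simp add: multistage_game_def)

lemma snoc_history: "h @ [a] \<in> histories G \<Longrightarrow> h \<in> histories G"
  using multistage by (auto simp: multistage_game_def)

lemma append_history: "h @ h' \<in> histories G \<Longrightarrow> h \<in> histories G"
proof (induction h' rule: rev_induct)
  case (snoc a h')
  then show ?case using snoc_history[of "h @ h'" a] by simp
qed simp

lemma take_history: "h \<in> histories G \<Longrightarrow> take k h \<in> histories G"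
  using append_history[of "take k h" "drop k h"] by simp

lemma take_snoc_history:
  assumes "z \<in> histories G" "k < length z"
  shows "take k z @ [z ! k] \<in> histories G"
  using take_history[OF assms(1), of "Suc k"] assms(2) by (simp add: take_Suc_conv_app_nth)

lemma snoc_history_iff:
  assumes "h @ [b] \<in> histories G"
  shows "h @ [a] \<in> histories G \<longleftrightarrow> a \<in> stage_maps (movers G h) (\<lambda>i. actions G i h)"
proof -
  have "h \<in> histories G" "\<not> terminal G h"
    using assms snoc_history by (auto simp: terminal_def)
  then have "{a. h @ [a] \<in> histories G} = stage_maps (movers G h) (\<lambda>i. actions G i h)"
    using multistage unfolding multistage_game_def stage_maps_def by simp
  then show ?thesis by blast
qed

lemma stages_eq:
  assumes "h @ [b] \<in> histories G"
  shows "{a. h @ [a] \<in> histories G} = stage_maps (movers G h) (\<lambda>i. actions G i h)"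
  using snoc_history_iff[OF assms] by blast

lemma finite_actions:
  assumes "h @ [b] \<in> histories G" "i \<in> movers G h"
  shows "finite (actions G i h)" "actions G i h \<noteq> {}"
proof -
  have "h \<in> histories G" "\<not> terminal G h"
    using assms snoc_history by (auto simp: terminal_def)
  then have "finite (actions G i h)" "2 \<le> card (actions G i h)"
    using multistage assms(2) unfolding multistage_game_def by auto
  then show "finite (actions G i h)" "actions G i h \<noteq> {}" by auto
qed

lemma terminal_history: "terminal G z \<Longrightarrow> z \<in> histories G"
  by (simp add: terminal_def)

lemma finite_terminal: "finite {z. terminal G z}"
  by (rule finite_subset[OF _ finite_histories]) (auto simp: terminal_def)

lemma finite_payoff_types: "finite (payoff_types M i)"
  using valid by (simp add: valid_payoffs_def)

lemma set_prior: "set_pmf (prior M i) = payoff_types M i"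
  using valid by (simp add: valid_payoffs_def)

section \<open>Priors and the value of a plan against default play\<close>

definition others_prior :: "'i \<Rightarrow> ('i \<Rightarrow> 'q) pmf" where
  "others_prior i = Pi_pmf (- {i}) undefined (prior M)"

lemma set_others_prior: "set_pmf (others_prior i) = PiE (- {i}) (payoff_types M)"
  unfolding others_prior_def
  by (subst set_Pi_pmf) (auto simp: PiE_dflt_def PiE_def extensional_def set_prior)

lemma finite_others_prior: "finite (set_pmf (others_prior i))"
  unfolding set_others_prior by (intro finite_PiE) (auto simp: finite_payoff_types)

lemma initial_belief_eq:
  "initial_belief M T i ti = pair_pmf (others_prior i) (map_pmf snd (type_belief T i ti))"
  by (simp add: initial_belief_def others_prior_def)

text \<open>Only the moves of \<open>j\<close> are restricted, so the condition survives deviations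
  of the other players. A history is on the default path when it holds for all players at
  once.\<close>

definition follows :: "'i \<Rightarrow> 'q \<Rightarrow> ('i, 'a) history \<Rightarrow> bool" where
  "follows j \<theta>j h \<longleftrightarrow>
     (\<forall>k<length h. j \<in> movers G (take k h) \<longrightarrow> pmf (S0 j \<theta>j (take k h)) (the ((h ! k) j)) \<noteq> 0)"

definition others_prob :: "'i \<Rightarrow> ('i \<Rightarrow> 'q) \<Rightarrow> ('i, 'a) history \<Rightarrow> real" where
  "others_prob i \<theta> z =
     (\<Prod>k<length z. \<Prod>j\<in>movers G (take k z) - {i}. pmf (S0 j (\<theta> j) (take k z)) (the ((z ! k) j)))"

text \<open>Intersecting with \<open>{i}\<close> makes the factor \<open>1\<close> at the stages at which \<open>i\<close> has no move.\<close>

definition own_prob ::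
  "'i \<Rightarrow> 'i set \<Rightarrow> (('i, 'a) private_history \<Rightarrow> 'a pmf) \<Rightarrow> nat set \<Rightarrow> ('i, 'a) history \<Rightarrow> real" where
  "own_prob i D \<sigma> K z =
     (\<Prod>k\<in>K. \<Prod>j\<in>movers G (take k z) \<inter> {i}. pmf (\<sigma> (take k z, (z ! k) |` D)) (the ((z ! k) j)))"

definition passes :: "'i \<Rightarrow> 'i set \<Rightarrow> ('i, 'a) private_history \<Rightarrow> ('i, 'a) history \<Rightarrow> bool" where
  "passes i D = (\<lambda>(h, l) z. length h < length z \<and> take (length h) z = h \<and>
     (z ! length h) |` leaked G i D h = l)"

text \<open>The payoff at \<open>z\<close>, averaged over the others' payoff types with the
  probability of their default moves as weight. It carries all that the expected utility of
  \<open>i\<close> owes to the others, so a plan enters only through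
  \<open>own_prob\<close>.\<close>

definition gain :: "'i \<Rightarrow> 'q \<Rightarrow> ('i, 'a) history \<Rightarrow> real" where
  "gain i \<theta>i z = measure_pmf.expectation (others_prior i)
     (\<lambda>\<theta>. utility M i (outcome G z) (\<theta>(i := \<theta>i)) * others_prob i \<theta> z)"

text \<open>The normalising factor of Bayes' rule does not depend on the plan and is left out.\<close>

definition plan_value ::
  "'i \<Rightarrow> 'q \<Rightarrow> 'i set \<Rightarrow> (('i, 'a) private_history \<Rightarrow> 'a pmf) \<Rightarrow> ('i, 'a) private_history \<Rightarrow> real" where
  "plan_value i \<theta>i D \<sigma> hi =
     (\<Sum>z | terminal G z \<and> passes i D hi z. gain i \<theta>i z * own_prob i D \<sigma> {length (fst hi)..<length z} z)"

text \<open>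
  The leaked actions \<open>l\<close> are arbitrary; so the condition applies to moves that \<open>i\<close> observes as well,
  without relating what \<open>i\<close> and \<open>j\<close> observe.
\<close>

definition compliant :: "('i, 't) type_space \<Rightarrow> ('i, 'q, 't, 'a) strategies \<Rightarrow> 'i \<Rightarrow> 't \<Rightarrow> bool" where
  "compliant T S i ti \<longleftrightarrow>
     (\<forall>t \<in> snd ` set_pmf (type_belief T i ti). \<forall>j. j \<noteq> i \<longrightarrow> (\<forall>\<theta>j \<in> payoff_types M j.
        \<forall>h a l. h @ [a] \<in> histories G \<and> j \<in> movers G h \<and> follows j \<theta>j h \<longrightarrow>
          S j \<theta>j (t j) (h, l |` observed T j (t j)) = S0 j \<theta>j h))"

lemma compliantD:
  assumes "compliant T S i ti" "t \<in> snd ` set_pmf (type_belief T i ti)" "j \<noteq> i" "\<theta>j \<in> payoff_types M j"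
    and "h @ [a] \<in> histories G" "j \<in> movers G h" "follows j \<theta>j h"
  shows "S j \<theta>j (t j) (h, l |` observed T j (t j)) = S0 j \<theta>j h"
  using assms unfolding compliant_def by blast

text \<open>The likelihood collects the others' moves before \<open>h\<close> and the leaked ones at
  \<open>h\<close>, the continuation probability all remaining ones together with the moves of
  \<open>i\<close> from \<open>h\<close> on. In the product every move of the others along
  \<open>z\<close> occurs exactly once, and compliance turns it into a default move until its player
  leaves the support of the default strategy, where both sides vanish.\<close>

lemma likelihood_times_cont:
  assumes comp: "compliant T S i ti"
    and \<theta>: "\<theta> \<in> PiE (- {i}) (payoff_types M)" and t: "t \<in> snd ` set_pmf (type_belief T i ti)"
    and z: "terminal G z" "passes i (observed T i ti) (h, l) z"
  shows "likelihood G (observed_profile T (t(i := ti))) (\<lambda>j. S j (\<theta> j) (t j)) i (h, l) *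
     cont_prob G (observed_profile T (t(i := ti))) ((\<lambda>j. S j (\<theta> j) (t j))(i := \<sigma>)) i (h, l) z =
     others_prob i \<theta> z * own_prob i (observed T i ti) \<sigma> {length h..<length z} z"
proof -
  define D where "D = observed_profile T (t(i := ti))"
  define n where "n = length h"
  define L where "L = leaked G i (D i) h"
  have Di: "D i = observed T i ti" by (simp add: D_def observed_profile_def)
  have Dj: "j \<noteq> i \<Longrightarrow> D j = observed T j (t j)" for j by (simp add: D_def observed_profile_def)
  have n: "n < length z" "take n z = h" "(z ! n) |` L = l"
    using z(2) by (simp_all add: passes_def n_def L_def Di)
  have iL: "i \<notin> L" by (simp add: L_def leaked_def Di observed_irrefl)
  \<comment> \<open>At the stage after \<open>h\<close> the likelihood evaluates the leaked movers
    at \<open>l\<close>, the continuation evaluates the remaining movers at the full stage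
    \<open>z ! n\<close>. With \<open>Y\<close> a single family of factors \<open>A\<close> covers
    both.\<close>
  define Y where "Y k j = (if k = n \<and> j \<in> L then l else z ! k)" for k j
  define A where "A k j = pmf (S j (\<theta> j) (t j) (take k z, Y k j |` D j)) (the ((z ! k) j))" for k j
  define B where "B k = (\<Prod>j\<in>movers G (take k z) \<inter> {i}. pmf (\<sigma> (take k z, (z ! k) |` D i)) (the ((z ! k) j)))" for k
  have hk: "take k h = take k z" "h ! k = z ! k" if "k < n" for k
    using that n(2) by (auto simp: min_def)
  have lj: "l j = (z ! n) j" if "j \<in> L" for j
    using n(3) that by (auto simp: restrict_map_def)
  have lik: "likelihood G D (\<lambda>j. S j (\<theta> j) (t j)) i (h, l) =
      (\<Prod>k<n. \<Prod>j\<in>movers G (take k z) - {i}. A k j) * (\<Prod>j\<in>movers G (take n z) \<inter> L. A n j)"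
    unfolding likelihood_def stage_prob_def prod.case n_def[symmetric] L_def[symmetric] n(2)
    by (intro arg_cong2[where f = "(*)"] prod.cong refl)
       (auto simp: A_def Y_def hk n lj)
  \<comment> \<open>\<open>X\<close> is the set of movers already accounted for by the likelihood:
    \<open>L\<close> at stage \<open>n\<close>, and nobody afterwards.\<close>
  have stage: "stage_prob D ((\<lambda>j. S j (\<theta> j) (t j))(i := \<sigma>)) (movers G (take k z) - X) (take k z) (z ! k) =
      (\<Prod>j\<in>movers G (take k z) - X - {i}. A k j) * B k" if "k = n \<Longrightarrow> X = L" "k \<noteq> n \<Longrightarrow> X = {}" for k X
    using that iL
    by (subst stage_prob_split[of _ _ _ _ _ i], intro arg_cong2[where f = "(*)"])
       (cases "k = n"; auto simp: stage_prob_def A_def B_def Y_def intro!: prod.cong)+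
  have "cont_prob G D ((\<lambda>j. S j (\<theta> j) (t j))(i := \<sigma>)) i (h, l) z =
      stage_prob D ((\<lambda>j. S j (\<theta> j) (t j))(i := \<sigma>)) (movers G (take n z) - L) (take n z) (z ! n) *
      (\<Prod>k\<in>{Suc n..<length z}. stage_prob D ((\<lambda>j. S j (\<theta> j) (t j))(i := \<sigma>)) (movers G (take k z) - {}) (take k z) (z ! k))"
    using n unfolding cont_prob_def prod.case n_def[symmetric] L_def[symmetric] by simp
  also have "\<dots> = (\<Prod>j\<in>movers G (take n z) - L - {i}. A n j) * B n *
      (\<Prod>k\<in>{Suc n..<length z}. (\<Prod>j\<in>movers G (take k z) - {i}. A k j) * B k)"
    by (intro arg_cong2[where f = "(*)"] prod.cong refl) (subst stage; auto)+
  finally have cont: "cont_prob G D ((\<lambda>j. S j (\<theta> j) (t j))(i := \<sigma>)) i (h, l) z = \<dots>" .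
  have split: "(\<Prod>j\<in>movers G (take n z) - {i}. A n j) =
      (\<Prod>j\<in>movers G (take n z) \<inter> L. A n j) * (\<Prod>j\<in>movers G (take n z) - L - {i}. A n j)"
    using iL by (subst prod.union_disjoint[symmetric]) (auto intro!: prod.cong)
  have lt: "{..<length z} = {..<n} \<union> insert n {Suc n..<length z}" "{n..<length z} = insert n {Suc n..<length z}"
    using n(1) by auto
  have "likelihood G D (\<lambda>j. S j (\<theta> j) (t j)) i (h, l) *
      cont_prob G D ((\<lambda>j. S j (\<theta> j) (t j))(i := \<sigma>)) i (h, l) z =
      (\<Prod>k<length z. \<Prod>j\<in>movers G (take k z) - {i}. A k j) * (\<Prod>k\<in>{n..<length z}. B k)"
    unfolding lik cont lt
    by (subst prod.union_disjoint) (auto simp: split prod.distrib)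
  also have "(\<Prod>k<length z. \<Prod>j\<in>movers G (take k z) - {i}. A k j) = others_prob i \<theta> z"
    unfolding others_prob_def
  proof (rule prod_eq_until_zero)
    fix k j
    assume k: "k \<in> {..<length z}" and j: "j \<in> movers G (take k z) - {i}"
      and pos: "\<And>l. \<lbrakk>l \<in> {..<length z}; l < k; j \<in> movers G (take l z) - {i}\<rbrakk>
        \<Longrightarrow> pmf (S0 j (\<theta> j) (take l z)) (the ((z ! l) j)) \<noteq> 0"
    have "follows j (\<theta> j) (take k z)"
      using pos k j by (auto simp: follows_def min_def)
    moreover have "take k z @ [z ! k] \<in> histories G"
      using k z(1) take_snoc_history terminal_history by auto
    moreover have "\<theta> j \<in> payoff_types M j" using \<theta> j by auto
    ultimately have "S j (\<theta> j) (t j) (take k z, Y k j |` observed T j (t j)) = S0 j (\<theta> j) (take k z)"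
      using j by (intro compliantD[OF comp t]) auto
    then show "A k j = pmf (S0 j (\<theta> j) (take k z)) (the ((z ! k) j))"
      using j Dj[of j] by (simp add: A_def)
  qed auto
  finally show ?thesis
    unfolding D_def[symmetric] own_prob_def B_def Di n_def .
qed

end

section \<open>Bayesian updating\<close>

lemma finite_type_belief:
  fixes T :: "('i::finite, 't) type_space"
  assumes "feasible T" "ti \<in> leakage_types T i"
  shows "finite (set_pmf (type_belief T i ti))"
proof (rule finite_subset)
  show "set_pmf (type_belief T i ti) \<subseteq> leakage_orders \<times> PiE (- {i}) (leakage_types T)"
    using assms unfolding feasible_def by blast
  have "finite (PiE (- {i}) (leakage_types T))"
    using assms(1) by (intro finite_PiE) (auto simp: feasible_def)
  then show "finite ((leakage_orders :: 'i rel set) \<times> PiE (- {i}) (leakage_types T))"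
    by simp
qed

context default_play
begin

text \<open>The default strategies ignore leaked actions, so only the set observed by
  \<open>i\<close> enters and the same \<open>D\<close> can be used for all players.\<close>

definition default_likelihood :: "'i \<Rightarrow> 'i set \<Rightarrow> ('i \<Rightarrow> 'q) \<Rightarrow> ('i, 'a) private_history \<Rightarrow> real" where
  "default_likelihood i D \<theta> hi = likelihood G (\<lambda>_. D) (\<lambda>j (h, _). S0 j (\<theta> j) h) i hi"

definition total_likelihood :: "'i \<Rightarrow> 'i set \<Rightarrow> ('i, 'a) private_history \<Rightarrow> real" where
  "total_likelihood i D hi = measure_pmf.expectation (others_prior i) (\<lambda>\<theta>. default_likelihood i D \<theta> hi)"

text \<open>Compliance covers the moves of each player up to its first zero factor, which is enough
  for \<open>prod_eq_until_zero\<close>. The right-hand side does not mention \<open>t\<close>: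
  under compliance a private history carries no information about the others' leakage types.\<close>

lemma likelihood_eq:
  assumes comp: "compliant T S i ti"
    and \<theta>: "\<theta> \<in> PiE (- {i}) (payoff_types M)" and t: "t \<in> snd ` set_pmf (type_belief T i ti)"
    and h: "(h, l) \<in> private_histories G i (observed T i ti)"
  shows "likelihood G (observed_profile T (t(i := ti))) (\<lambda>j. S j (\<theta> j) (t j)) i (h, l) =
     default_likelihood i (observed T i ti) \<theta> (h, l)"
proof -
  define D where "D = observed_profile T (t(i := ti))"
  define n where "n = length h"
  define L where "L = leaked G i (D i) h"
  have Di: "D i = observed T i ti" by (simp add: D_def observed_profile_def)
  have Dj: "j \<noteq> i \<Longrightarrow> D j = observed T j (t j)" for j by (simp add: D_def observed_profile_def)
  obtain a where a: "h @ [a] \<in> histories G"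
    using h by (auto simp: mem_private_histories)
  have iL: "i \<notin> L" by (simp add: L_def leaked_def Di observed_irrefl)
  \<comment> \<open>The leaked moves at \<open>h\<close> are treated as one more stage, with index
    \<open>n\<close>, so that past and leaked moves form one double product.\<close>
  define X where "X k = (if k < n then h ! k else l)" for k
  define J where "J k = (if k < n then movers G (take k h) - {i} else movers G h \<inter> L)" for k
  have "likelihood G D (\<lambda>j. S j (\<theta> j) (t j)) i (h, l) =
    (\<Prod>k\<in>{..<Suc n}. \<Prod>j\<in>J k. pmf (S j (\<theta> j) (t j) (take k h, X k |` D j)) (the (X k j)))"
    unfolding likelihood_def stage_prob_def prod.case n_def[symmetric] L_def[symmetric]
      prod.lessThan_Suc
    by (simp add: X_def J_def n_def)
  also have "\<dots> = (\<Prod>k\<in>{..<Suc n}. \<Prod>j\<in>J k. pmf (S0 j (\<theta> j) (take k h)) (the (X k j)))"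
  proof (rule prod_eq_until_zero)
    fix k j
    assume k: "k \<in> {..<Suc n}" and j: "j \<in> J k"
      and pos: "\<And>l. \<lbrakk>l \<in> {..<Suc n}; l < k; j \<in> J l\<rbrakk> \<Longrightarrow> pmf (S0 j (\<theta> j) (take l h)) (the (X l j)) \<noteq> 0"
    have ji: "j \<noteq> i" "j \<in> movers G (take k h)"
      using j iL k by (auto simp: J_def n_def split: if_splits)
    have "follows j (\<theta> j) (take k h)"
      unfolding follows_def
    proof (intro allI impI)
      fix m assume m: "m < length (take k h)" "j \<in> movers G (take m (take k h))"
      then have "m < k" "m < n" by (auto simp: n_def)
      then show "pmf (S0 j (\<theta> j) (take m (take k h))) (the ((take k h ! m) j)) \<noteq> 0"
        using pos[of m] m ji by (auto simp: J_def X_def min_def)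
    qed
    moreover have "\<exists>b. take k h @ [b] \<in> histories G"
    proof (cases "k < n")
      case True
      then show ?thesis
        using take_snoc_history[OF snoc_history[OF a], of k] by (auto simp: n_def)
    next
      case False
      then show ?thesis using a k by (auto simp: n_def)
    qed
    moreover have "\<theta> j \<in> payoff_types M j" using \<theta> ji by auto
    ultimately have "S j (\<theta> j) (t j) (take k h, X k |` observed T j (t j)) = S0 j (\<theta> j) (take k h)"
      using ji by (auto intro: compliantD[OF comp t])
    then show "pmf (S j (\<theta> j) (t j) (take k h, X k |` D j)) (the (X k j)) =
      pmf (S0 j (\<theta> j) (take k h)) (the (X k j))"
      using ji Dj[of j] by simp
  qed (auto simp: J_def)
  also have "\<dots> = default_likelihood i (observed T i ti) \<theta> (h, l)"
    unfolding default_likelihood_def likelihood_def stage_prob_def prod.case n_def[symmetric]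
      Di[symmetric] L_def[symmetric] prod.lessThan_Suc
    by (simp add: X_def J_def n_def)
  finally show ?thesis by (simp add: D_def)
qed

lemma default_likelihood_nonneg: "0 \<le> default_likelihood i D \<theta> hi"
  by (cases hi) (auto simp: default_likelihood_def likelihood_def stage_prob_def intro!: mult_nonneg_nonneg prod_nonneg)

lemma default_play_prob: "reach_prob G D (\<lambda>j (h, _). S0 j (\<theta> j) h) h =
  (\<Prod>k<length h. \<Prod>j\<in>movers G (take k h). pmf (S0 j (\<theta> j) (take k h)) (the ((h ! k) j)))"
  by (simp add: reach_prob_def stage_prob_def)

lemma reach_pos_iff_follows: "reach_prob G D (\<lambda>j (h, _). S0 j (\<theta> j) h) h > 0 \<longleftrightarrow> (\<forall>j. follows j (\<theta> j) h)"
proof -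
  have "reach_prob G D (\<lambda>j (h, _). S0 j (\<theta> j) h) h \<ge> 0"
    unfolding default_play_prob by (intro prod_nonneg) simp
  then have "reach_prob G D (\<lambda>j (h, _). S0 j (\<theta> j) h) h > 0 \<longleftrightarrow>
      reach_prob G D (\<lambda>j (h, _). S0 j (\<theta> j) h) h \<noteq> 0" by linarith
  also have "\<dots> \<longleftrightarrow> (\<forall>j. follows j (\<theta> j) h)"
    unfolding default_play_prob by (auto simp: follows_def)
  finally show ?thesis .
qed

lemma on_path_iff: "on_path G S0 \<theta> h \<longleftrightarrow> h \<in> histories G \<and> (\<forall>j. follows j (\<theta> j) h)"
  by (simp add: on_path_def reach_pos_iff_follows)

text \<open>Pruning provides types under which default play reaches \<open>h\<close> followed by a
  stage \<open>a\<close> that leaks exactly \<open>l\<close>. Restricted to the others they have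
  positive prior probability, since the prior has full support, and positive likelihood. Hence
  Bayes' rule determines the belief at every private history, also after deviations of
  \<open>i\<close>, whose moves the likelihood leaves out.\<close>

lemma total_likelihood_pos:
  assumes pruned: "pruned M G S0" and h: "(h, l) \<in> private_histories G i D" and i: "i \<notin> D"
  shows "total_likelihood i D (h, l) > 0"
proof -
  obtain a where a: "h @ [a] \<in> histories G" "l = a |` leaked G i D h"
    using h by (auto simp: mem_private_histories)
  then obtain \<theta> where \<theta>: "\<theta> \<in> payoff_profiles M" "\<And>j. follows j (\<theta> j) (h @ [a])"
    using pruned by (auto simp: pruned_def on_path_iff)
  define \<theta>' where "\<theta>' = restrict \<theta> (- {i})"
  have \<theta>': "\<theta>' \<in> set_pmf (others_prior i)"
    using \<theta>(1) by (auto simp: set_others_prior \<theta>'_def payoff_profiles_def)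
  have pos: "pmf (S0 j (\<theta> j) (take k h)) (the ((h ! k) j)) > 0"
    if "k < length h" "j \<in> movers G (take k h)" for k j
    using \<theta>(2)[of j] that by (auto simp: follows_def pmf_pos nth_append dest!: spec[of _ k])
  have pos': "pmf (S0 j (\<theta> j) h) (the (a j)) > 0" if "j \<in> movers G h" for j
    using \<theta>(2)[of j] that by (auto simp: follows_def pmf_pos nth_append dest!: spec[of _ "length h"])
  have "default_likelihood i D \<theta>' (h, l) > 0"
    unfolding default_likelihood_def likelihood_def stage_prob_def prod.case
  proof (intro mult_pos_pos prod_pos ballI)
    fix k j assume "k \<in> {..<length h}" "j \<in> movers G (take k h) - {i}"
    then show "0 < pmf (S0 j (\<theta>' j) (take k h)) (the ((h ! k) j))"
      using pos[of k j] by (simp add: \<theta>'_def)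
  next
    fix j assume j: "j \<in> movers G h \<inter> leaked G i D h"
    then have "j \<noteq> i" using i by (auto simp: leaked_def split: if_splits)
    then show "0 < pmf (S0 j (\<theta>' j) h) (the (l j))"
      using pos'[of j] j by (simp add: \<theta>'_def a(2))
  qed
  then have "0 < pmf (others_prior i) \<theta>' * default_likelihood i D \<theta>' (h, l)"
    using \<theta>' by (simp add: pmf_positive)
  also have "\<dots> \<le> (\<Sum>\<theta>\<in>set_pmf (others_prior i). pmf (others_prior i) \<theta> * default_likelihood i D \<theta> (h, l))"
    using \<theta>' finite_others_prior by (intro member_le_sum) (auto intro!: mult_nonneg_nonneg default_likelihood_nonneg)
  also have "\<dots> = total_likelihood i D (h, l)"
    by (simp add: total_likelihood_def finite_support_expectation[OF finite_others_prior order_refl])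
  finally show ?thesis .
qed

lemma expectation_initial_belief_fst:
  fixes F :: "('i \<Rightarrow> 'q) \<Rightarrow> real"
  shows "measure_pmf.expectation (initial_belief M T i ti) (\<lambda>x. F (fst x)) =
    measure_pmf.expectation (others_prior i) F"
  using integral_map_pmf[of fst "initial_belief M T i ti" F]
  by (simp add: initial_belief_eq map_fst_pair_pmf)

lemma set_initial_belief: "set_pmf (initial_belief M T i ti) =
  PiE (- {i}) (payoff_types M) \<times> snd ` set_pmf (type_belief T i ti)"
  by (simp add: initial_belief_eq set_others_prior)

lemma total_likelihood_eq:
  assumes comp: "compliant T S i ti"
    and h: "hi \<in> private_histories G i (observed T i ti)"
  shows "measure_pmf.expectation (initial_belief M T i ti)
      (\<lambda>(\<theta>, t). likelihood G (observed_profile T (t(i := ti))) (\<lambda>j. S j (\<theta> j) (t j)) i hi) =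
    total_likelihood i (observed T i ti) hi"
proof -
  have "(case x of (\<theta>, t) \<Rightarrow> likelihood G (observed_profile T (t(i := ti))) (\<lambda>j. S j (\<theta> j) (t j)) i hi) =
    default_likelihood i (observed T i ti) (fst x) hi" if "x \<in> set_pmf (initial_belief M T i ti)" for x
  proof -
    have x: "fst x \<in> PiE (- {i}) (payoff_types M)" "snd x \<in> snd ` set_pmf (type_belief T i ti)"
      using that unfolding set_initial_belief by (simp_all add: mem_Times_iff)
    show ?thesis
      using likelihood_eq[OF comp x, of "fst hi" "snd hi"] h by (simp add: split_beta)
  qed
  then have "measure_pmf.expectation (initial_belief M T i ti)
      (\<lambda>(\<theta>, t). likelihood G (observed_profile T (t(i := ti))) (\<lambda>j. S j (\<theta> j) (t j)) i hi) =
    measure_pmf.expectation (initial_belief M T i ti) (\<lambda>x. default_likelihood i (observed T i ti) (fst x) hi)"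
    by (intro integral_cong_AE) (auto simp: AE_measure_pmf_iff)
  then show ?thesis
    unfolding total_likelihood_def
      expectation_initial_belief_fst[of _ _ _ "\<lambda>\<theta>. default_likelihood i (observed T i ti) \<theta> hi"] .
qed

text \<open>By Bayes' rule the posterior weight of a pair of types is its prior weight times its
  likelihood, divided by \<open>total_likelihood\<close>. Multiplied by the continuation probability
  it no longer involves leakage types beyond the prior, which can then be replaced by its marginal
  on payoff types. The denominator is positive and free of \<open>\<sigma>\<close>, so optimality
  under beliefs becomes optimality for \<open>plan_value\<close>.\<close>

lemma expected_utility_eq:
  fixes T :: "('i, 't) type_space"
  assumes comp: "compliant T S i ti" and fin: "finite (set_pmf (type_belief T i ti))"
    and pruned: "pruned M G S0"
    and h: "hi \<in> private_histories G i (observed T i ti)"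
    and bayes: "bayes_consistent M G T S \<mu> i ti hi"
  shows "expected_utility M G T S \<mu> i \<theta>i ti hi \<sigma> =
    plan_value i \<theta>i (observed T i ti) \<sigma> hi / total_likelihood i (observed T i ti) hi"
proof -
  define I where "I = set_pmf (initial_belief M T i ti)"
  define p where "p = pmf (initial_belief M T i ti)"
  define c where "c = total_likelihood i (observed T i ti) hi"
  define D where "D t = observed_profile T (t(i := ti))" for t
  define lik where "lik = (\<lambda>(\<theta>, t). likelihood G (D t) (\<lambda>j. S j (\<theta> j) (t j)) i hi)"
  define cp where "cp = (\<lambda>z (\<theta>, t). cont_prob G (D t) ((\<lambda>j. S j (\<theta> j) (t j))(i := \<sigma>)) i hi z)"
  define u where "u z x = utility M i (outcome G z) ((fst x)(i := \<theta>i))" for z and x :: "('i \<Rightarrow> 'q) \<times> ('i \<Rightarrow> 't)"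
  define Z where "Z = {z. terminal G z}"
  have finI: "finite I"
    unfolding I_def set_initial_belief using fin finite_others_prior[of i]
    by (auto simp: set_others_prior)
  obtain h' l' where hi: "hi = (h', l')" by force
  have c: "c > 0"
    unfolding c_def hi
    by (rule total_likelihood_pos) (use h pruned in \<open>simp_all add: observed_irrefl hi\<close>)
  have tot: "measure_pmf.expectation (initial_belief M T i ti) lik = c"
    using total_likelihood_eq[OF comp h] unfolding lik_def D_def c_def .
  have \<mu>: "pmf (\<mu> i hi ti) x = p x * lik x / c" for x
    using bayes c unfolding bayes_consistent_def Let_def D_def[symmetric] lik_def[symmetric] tot p_def
    by blast
  have sub: "set_pmf (\<mu> i hi ti) \<subseteq> I"
    using \<mu> by (auto simp: set_pmf_eq I_def p_def)
  have prod: "lik x * cp z x = (if passes i (observed T i ti) hi z then others_prob i (fst x) z *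
      own_prob i (observed T i ti) \<sigma> {length h'..<length z} z else 0)" if "x \<in> I" "z \<in> Z" for x z
  proof (cases "passes i (observed T i ti) hi z")
    case True
    have x: "fst x \<in> PiE (- {i}) (payoff_types M)" "snd x \<in> snd ` set_pmf (type_belief T i ti)"
      using that(1) unfolding I_def set_initial_belief by (simp_all add: mem_Times_iff)
    have "terminal G z" using that(2) by (simp add: Z_def)
    from likelihood_times_cont[OF comp x this True[unfolded hi], of \<sigma>] True show ?thesis
      unfolding lik_def cp_def hi D_def by (simp add: split_beta)
  next
    case False
    then have "cp z x = 0"
      by (auto simp: cp_def passes_def hi cont_prob_def D_def observed_profile_def split: prod.splits)
    then show ?thesis using False by simp
  qed
  have "expected_utility M G T S \<mu> i \<theta>i ti hi \<sigma> =
      (\<Sum>x\<in>I. pmf (\<mu> i hi ti) x * (\<Sum>z\<in>Z. u z x * cp z x))"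
    unfolding expected_utility_def finite_support_expectation[OF finI sub] cont_utility_def
      Z_def u_def cp_def D_def by (auto intro!: sum.cong)
  also have "\<dots> = (\<Sum>x\<in>I. \<Sum>z\<in>Z. p x * u z x * (lik x * cp z x) / c)"
    unfolding \<mu> by (auto simp: sum_distrib_left intro!: sum.cong)
  also have "\<dots> = (\<Sum>x\<in>I. \<Sum>z\<in>Z. p x * u z x * (if passes i (observed T i ti) hi z then others_prob i (fst x) z *
      own_prob i (observed T i ti) \<sigma> {length h'..<length z} z else 0) / c)"
    using prod by (auto intro!: sum.cong)
  also have "\<dots> = (\<Sum>z\<in>Z. \<Sum>x\<in>I. p x * u z x * (if passes i (observed T i ti) hi z then others_prob i (fst x) z *
      own_prob i (observed T i ti) \<sigma> {length h'..<length z} z else 0) / c)"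
    by (rule sum.swap)
  also have "\<dots> = (\<Sum>z\<in>Z. if passes i (observed T i ti) hi z then (\<Sum>x\<in>I. p x * (u z x * others_prob i (fst x) z)) *
      own_prob i (observed T i ti) \<sigma> {length h'..<length z} z / c else 0)"
    by (intro sum.cong) (auto simp: sum_distrib_left sum_distrib_right sum_divide_distrib mult_ac)
  also have "\<dots> = (\<Sum>z\<in>Z. if passes i (observed T i ti) hi z then gain i \<theta>i z *
      own_prob i (observed T i ti) \<sigma> {length h'..<length z} z / c else 0)"
  proof -
    have gain: "(\<Sum>x\<in>I. p x * (u z x * others_prob i (fst x) z)) = gain i \<theta>i z" for z
    proof -
      have "(\<Sum>x\<in>I. p x * (u z x * others_prob i (fst x) z)) = measure_pmf.expectation (initial_belief M T i ti)
        (\<lambda>x. utility M i (outcome G z) ((fst x)(i := \<theta>i)) * others_prob i (fst x) z)"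
        unfolding I_def p_def by (subst finite_support_expectation[OF finI[unfolded I_def] order_refl])
           (auto simp: u_def intro!: sum.cong)
      then show ?thesis
        unfolding gain_def expectation_initial_belief_fst[of _ _ _ "\<lambda>\<theta>. utility M i (outcome G z) (\<theta>(i := \<theta>i)) * others_prob i \<theta> z"] .
    qed
    show ?thesis by (simp only: gain)
  qed
  also have "\<dots> = plan_value i \<theta>i (observed T i ti) \<sigma> hi / c"
    unfolding plan_value_def sum_divide_distrib
    by (rule sum.mono_neutral_cong_right) (auto simp: Z_def finite_terminal hi)
  finally show ?thesis by (simp add: c_def)
qed

text \<open>The witness is prior times likelihood, normalised. \<open>bayes_consistent\<close>
  inspects \<open>\<mu>\<close> only at \<open>i hi ti\<close>, hence the quantification over all
  \<open>\<mu>\<close> with the given value there: beliefs can be chosen separately for each private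
  history.\<close>

lemma Bayes_belief_exists:
  assumes comp: "compliant T S i ti" and fin: "finite (set_pmf (type_belief T i ti))"
    and pruned: "pruned M G S0"
    and h: "hi \<in> private_histories G i (observed T i ti)"
  obtains p where "\<And>\<mu>. \<mu> i hi ti = p \<Longrightarrow> bayes_consistent M G T S \<mu> i ti hi"
    "set_pmf p \<subseteq> set_pmf (initial_belief M T i ti)"
proof -
  define I where "I = set_pmf (initial_belief M T i ti)"
  define c where "c = total_likelihood i (observed T i ti) hi"
  define lik where "lik = (\<lambda>(\<theta>, t). likelihood G (observed_profile T (t(i := ti))) (\<lambda>j. S j (\<theta> j) (t j)) i hi)"
  define q where "q x = pmf (initial_belief M T i ti) x * lik x / c" for x
  obtain h' l' where hi: "hi = (h', l')" by force
  have c: "c > 0"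
    unfolding c_def hi
    by (rule total_likelihood_pos) (use h pruned in \<open>simp_all add: observed_irrefl hi\<close>)
  have finI: "finite I"
    unfolding I_def set_initial_belief using fin finite_others_prior[of i]
    by (auto simp: set_others_prior)
  have "lik x \<ge> 0" for x
    unfolding lik_def hi likelihood_def stage_prob_def
    by (auto split: prod.splits intro!: mult_nonneg_nonneg prod_nonneg)
  then have q: "q x \<ge> 0" for x
    using c by (simp add: q_def)
  have tot: "measure_pmf.expectation (initial_belief M T i ti) lik = c"
    using total_likelihood_eq[OF comp h] by (simp add: lik_def c_def)
  then have "(\<Sum>x\<in>I. q x) = 1"
    using c finite_support_expectation[OF finI, of "initial_belief M T i ti" lik]
    by (simp add: q_def I_def sum_divide_distrib[symmetric])
  moreover have "(\<integral>\<^sup>+ x. ennreal (q x) \<partial>count_space UNIV) = (\<Sum>x\<in>I. ennreal (q x))"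
    by (rule nn_integral_count_space'[OF finI]) (auto simp: q_def I_def set_pmf_eq)
  ultimately have nn: "(\<integral>\<^sup>+ x. ennreal (q x) \<partial>count_space UNIV) = 1"
    using q by simp
  have pmf: "pmf (embed_pmf q) x = q x" for x
    by (rule pmf_embed_pmf[OF q nn])
  show ?thesis
  proof
    show "bayes_consistent M G T S \<mu> i ti hi" if "\<mu> i hi ti = embed_pmf q" for \<mu>
      using tot unfolding bayes_consistent_def Let_def that pmf lik_def[symmetric] by (simp add: q_def)
    show "set_pmf (embed_pmf q) \<subseteq> set_pmf (initial_belief M T i ti)"
      by (auto simp: set_pmf_eq pmf) (auto simp: q_def)
  qed
qed

section \<open>Optimal plans\<close>

definition default_plan :: "'i \<Rightarrow> 'q \<Rightarrow> ('i, 'a) private_history \<Rightarrow> 'a pmf" where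
  "default_plan i \<theta>i = (\<lambda>(h, _). S0 i \<theta>i h)"

lemma default_plan_in_plans:
  "\<theta>i \<in> payoff_types M i \<Longrightarrow> default_plan i \<theta>i \<in> plans G i D"
  using S0_actions by (fastforce simp: plans_def mem_private_histories default_plan_def)

lemma own_prob_eq_until_zero:
  assumes "finite K"
    and "\<And>k. \<lbrakk>k \<in> K; i \<in> movers G (take k z);
        \<And>l. l \<in> K \<Longrightarrow> l < k \<Longrightarrow> i \<in> movers G (take l z) \<Longrightarrow>
          pmf (\<sigma>' (take l z, (z ! l) |` D')) (the ((z ! l) i)) \<noteq> 0\<rbrakk> \<Longrightarrow>
      \<sigma> (take k z, (z ! k) |` D) = \<sigma>' (take k z, (z ! k) |` D')"
  shows "own_prob i D \<sigma> K z = own_prob i D' \<sigma>' K z"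
  unfolding own_prob_def by (rule prod_eq_until_zero) (use assms in auto)

lemma own_prob_cong:
  assumes "\<And>k. k \<in> K \<Longrightarrow> i \<in> movers G (take k z) \<Longrightarrow>
      \<sigma> (take k z, (z ! k) |` D) = \<sigma>' (take k z, (z ! k) |` D')"
  shows "own_prob i D \<sigma> K z = own_prob i D' \<sigma>' K z"
  unfolding own_prob_def by (intro prod.cong refl) (use assms in auto)

lemma own_prob_split:
  "m \<le> n \<Longrightarrow> n \<le> N \<Longrightarrow>
   own_prob i D \<sigma> {m..<N} z = own_prob i D \<sigma> {m..<n} z * own_prob i D \<sigma> {n..<N} z"
  unfolding own_prob_def by (rule prod.atLeastLessThan_concat[symmetric])

section \<open>Dynamic programming for plan values\<close>

lemma plan_value_cong:
  assumes "\<And>h' l'. length (fst hi) \<le> length h' \<Longrightarrow> \<sigma> (h', l') = \<tau> (h', l')"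
  shows "plan_value i \<theta>i D \<sigma> hi = plan_value i \<theta>i D \<tau> hi"
  unfolding plan_value_def
  by (intro sum.cong refl arg_cong2[where f = "(*)"] own_prob_cong assms) auto

text \<open>Terminal histories with a further stage are grouped by the private history that
  \<open>i\<close> has there, and each group contributes exactly the plan value at that private
  history. The histories that end before it contribute the same under both plans. The predicate
  \<open>R\<close> makes it possible to fix the action of \<open>i\<close> at
  \<open>h\<close>.\<close>

lemma continuation_value_mono:
  assumes better: "\<And>hi. hi \<in> private_histories G i D \<Longrightarrow> length (fst hi) = Suc (length h) \<Longrightarrow>
      plan_value i \<theta>i D \<tau> hi \<le> plan_value i \<theta>i D \<sigma> hi"
    and A: "A = {z. terminal G z \<and> passes i D (h, l) z \<and> R (z ! length h)}"
  shows "(\<Sum>z\<in>A. gain i \<theta>i z * own_prob i D \<tau> {Suc (length h)..<length z} z) \<le>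
         (\<Sum>z\<in>A. gain i \<theta>i z * own_prob i D \<sigma> {Suc (length h)..<length z} z)"
proof -
  define n where "n = length h"
  define A' where "A' = {z \<in> A. Suc n < length z}"
  define key where "key z = (take (Suc n) z, (z ! Suc n) |` leaked G i D (take (Suc n) z))" for z
  have fin: "finite A" "finite A'"
    using finite_terminal by (auto simp: A A'_def)
  \<comment> \<open>The key contains the first \<open>Suc n\<close> stages, so it decides membership
    in \<open>A\<close>; each fiber is therefore the whole set over which \<open>plan_value\<close>
    sums.\<close>
  have fiber: "{z \<in> A'. key z = y} = {z. terminal G z \<and> passes i D y z}" if y: "y \<in> key ` A'" for y
  proof -
    obtain z0 where z0: "z0 \<in> A'" "y = key z0" using y by blast
    have z0': "take n z0 = h" "(z0 ! n) |` leaked G i D h = l" "R (z0 ! n)" "Suc n < length z0"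
      using z0 by (auto simp: A'_def A passes_def n_def)
    have "z \<in> A' \<and> key z = y \<longleftrightarrow> terminal G z \<and> passes i D y z" for z
    proof
      assume "z \<in> A' \<and> key z = y"
      then show "terminal G z \<and> passes i D y z"
        using z0' by (auto simp: A'_def A key_def passes_def)
    next
      assume z: "terminal G z \<and> passes i D y z"
      then have t: "Suc n < length z" "take (Suc n) z = take (Suc n) z0"
          "(z ! Suc n) |` leaked G i D (take (Suc n) z0) = (z0 ! Suc n) |` leaked G i D (take (Suc n) z0)"
        using z0' by (auto simp: z0(2) key_def passes_def min_def)
      have "take n z = take n z0" using t(2) by (metis le_add2 min.absorb1 plus_1_eq_Suc take_take)
      moreover have "z ! n = z0 ! n" using t(2) by (metis lessI nth_take)
      ultimately show "z \<in> A' \<and> key z = y"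
        using z t z0' by (simp add: A'_def A passes_def n_def[symmetric] key_def z0(2))
    qed
    then show ?thesis by blast
  qed
  have val: "(\<Sum>z\<in>A'. gain i \<theta>i z * own_prob i D \<rho> {Suc n..<length z} z) =
      (\<Sum>y\<in>key ` A'. plan_value i \<theta>i D \<rho> y)" for \<rho>
  proof (subst sum.image_gen[OF fin(2), of _ key], intro sum.cong refl)
    fix y assume y: "y \<in> key ` A'"
    then have "length (fst y) = Suc n"
      by (auto simp: key_def A'_def)
    then show "(\<Sum>z\<in>{z \<in> A'. key z = y}. gain i \<theta>i z * own_prob i D \<rho> {Suc n..<length z} z) = plan_value i \<theta>i D \<rho> y"
      unfolding plan_value_def fiber[OF y] by simp
  qed
  have split: "(\<Sum>z\<in>A. gain i \<theta>i z * own_prob i D \<rho> {Suc n..<length z} z) =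
      (\<Sum>z\<in>A - A'. gain i \<theta>i z) + (\<Sum>y\<in>key ` A'. plan_value i \<theta>i D \<rho> y)" for \<rho>
  proof -
    have "own_prob i D \<rho> {Suc n..<length z} z = 1" if z: "z \<in> A - A'" for z
    proof -
      have "{Suc n..<length z} = {}" using z by (auto simp: A'_def)
      then show ?thesis by (simp add: own_prob_def)
    qed
    then show ?thesis
      unfolding val[symmetric] using fin
      by (subst sum.subset_diff[of A' A]) (auto simp: A'_def)
  qed
  have "plan_value i \<theta>i D \<tau> y \<le> plan_value i \<theta>i D \<sigma> y" if y: "y \<in> key ` A'" for y
  proof (rule better)
    obtain z where z: "z \<in> A'" "y = key z" using y by blast
    have "take (Suc n) z @ [z ! Suc n] \<in> histories G"
      using z(1) terminal_history take_snoc_history by (auto simp: A'_def A)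
    then show "y \<in> private_histories G i D"
      unfolding z(2) key_def mem_private_histories by blast
    show "length (fst y) = Suc (length h)"
      using z by (auto simp: key_def A'_def n_def)
  qed
  then show ?thesis
    unfolding n_def[symmetric] split by (intro add_left_mono sum_mono)
qed

text \<open>With \<open>l\<close> fixed, the first own factor depends on \<open>z\<close> only
  through the action of \<open>i\<close>, so grouping by that action gives a one-step
  recursion.\<close>

lemma plan_value_mover:
  assumes "i \<in> movers G h" and hist: "(h, l) \<in> private_histories G i D" and \<tau>: "\<tau> \<in> plans G i D"
  shows "plan_value i \<theta>i D \<tau> (h, l) = (\<Sum>a\<in>actions G i h. pmf (\<tau> (h, l)) a *
    (\<Sum>z | terminal G z \<and> passes i D (h, l) z \<and> the ((z ! length h) i) = a.
       gain i \<theta>i z * own_prob i D \<tau> {Suc (length h)..<length z} z))"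
proof -
  define Z where "Z = {z. terminal G z \<and> passes i D (h, l) z}"
  define f where "f z = gain i \<theta>i z * own_prob i D \<tau> {Suc (length h)..<length z} z" for z
  have fin: "finite Z" using finite_terminal by (auto simp: Z_def)
  obtain b where b: "h @ [b] \<in> histories G" using hist by (auto simp: mem_private_histories)
  have act: "(\<lambda>z. the ((z ! length h) i)) ` Z \<subseteq> actions G i h"
  proof safe
    fix z assume "z \<in> Z"
    then have "h @ [z ! length h] \<in> histories G"
      using take_snoc_history[of z "length h"] by (auto simp: Z_def passes_def terminal_history)
    then show "the ((z ! length h) i) \<in> actions G i h"
      using snoc_history_iff[OF b] assms(1) by (auto simp: stage_maps_def)
  qed
  have "plan_value i \<theta>i D \<tau> (h, l) = (\<Sum>z\<in>Z. pmf (\<tau> (h, l)) (the ((z ! length h) i)) * f z)"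
    unfolding plan_value_def Z_def fst_conv
  proof (intro sum.cong refl)
    fix z assume z: "z \<in> {z. terminal G z \<and> passes i D (h, l) z}"
    then have z': "length h < length z" "take (length h) z = h" "(z ! length h) |` D = l"
      using assms(1) by (auto simp: passes_def leaked_def)
    have "movers G h \<inter> {i} = {i}" using assms(1) by auto
    then have "own_prob i D \<tau> {length h..<Suc (length h)} z = pmf (\<tau> (h, l)) (the ((z ! length h) i))"
      using z' by (simp add: own_prob_def)
    then show "gain i \<theta>i z * own_prob i D \<tau> {length h..<length z} z =
        pmf (\<tau> (h, l)) (the ((z ! length h) i)) * f z"
      using own_prob_split[of "length h" "Suc (length h)" "length z" i D \<tau> z] z'(1) by (simp add: f_def)
  qed
  also have "\<dots> = (\<Sum>a\<in>actions G i h. \<Sum>z\<in>{z \<in> Z. the ((z ! length h) i) = a}.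
      pmf (\<tau> (h, l)) (the ((z ! length h) i)) * f z)"
    by (rule sum.group[symmetric]) (use fin act finite_actions[OF b assms(1)] in auto)
  also have "\<dots> = (\<Sum>a\<in>actions G i h. pmf (\<tau> (h, l)) a * (\<Sum>z\<in>{z \<in> Z. the ((z ! length h) i) = a}. f z))"
    by (intro sum.cong refl) (simp add: sum_distrib_left)
  finally show ?thesis
    by (simp add: Z_def f_def conj_assoc)
qed

text \<open>The conjunct \<open>True\<close> gives the index set the form expected by
  \<open>continuation_value_mono\<close> with a trivial \<open>R\<close>.\<close>

lemma plan_value_not_mover:
  assumes "i \<notin> movers G h"
  shows "plan_value i \<theta>i D \<tau> (h, l) =
    (\<Sum>z | terminal G z \<and> passes i D (h, l) z \<and> True. gain i \<theta>i z * own_prob i D \<tau> {Suc (length h)..<length z} z)"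
  unfolding plan_value_def
proof (intro sum.cong)
  fix z assume z: "z \<in> {z. terminal G z \<and> passes i D (h, l) z \<and> True}"
  then have z': "length h < length z" "take (length h) z = h"
    by (auto simp: passes_def)
  have "own_prob i D \<tau> {length h..<Suc (length h)} z = 1"
    using z' assms by (simp add: own_prob_def)
  then show "gain i \<theta>i z * own_prob i D \<tau> {length (fst (h, l))..<length z} z =
      gain i \<theta>i z * own_prob i D \<tau> {Suc (length h)..<length z} z"
    using own_prob_split[of "length h" "Suc (length h)" "length z" i D \<tau> z] z'(1) by simp
qed simp

text \<open>Backward induction on the length of the history. A plan value depends on the plan only
  at its history and later, and its weights are fixed, so maximising layer by layer yields one plan
  that is optimal at all private histories at once, also at those which it avoids itself.\<close>

lemma optimal_plan_exists:
  assumes \<theta>i: "\<theta>i \<in> payoff_types M i"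
  obtains \<sigma> where "\<sigma> \<in> plans G i D"
    "\<And>hi \<tau>. hi \<in> private_histories G i D \<Longrightarrow> \<tau> \<in> plans G i D \<Longrightarrow>
       plan_value i \<theta>i D \<tau> hi \<le> plan_value i \<theta>i D \<sigma> hi"
proof -
  \<comment> \<open>\<open>N\<close> exceeds the length of every history; below, \<open>m\<close>
    counts the layers from the end that are already optimised, starting with an empty one.\<close>
  define N where "N = Suc (Max (length ` histories G))"
  have N: "length h < N" if "h \<in> histories G" for h
    using that finite_histories by (auto simp: N_def less_Suc_eq_le)
  have "\<exists>\<sigma>\<in>plans G i D. \<forall>hi\<in>private_histories G i D. N \<le> length (fst hi) + m \<longrightarrow>
      (\<forall>\<tau>\<in>plans G i D. plan_value i \<theta>i D \<tau> hi \<le> plan_value i \<theta>i D \<sigma> hi)" for m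
  proof (induction m)
    case 0
    have "length (fst hi) < N" if "hi \<in> private_histories G i D" for hi
      using that N snoc_history by (cases hi) (auto simp: mem_private_histories)
    then show ?case
      using default_plan_in_plans[OF \<theta>i] by fastforce
  next
    case (Suc m)
    then obtain \<sigma> where \<sigma>: "\<sigma> \<in> plans G i D"
      and opt: "\<And>hi \<tau>. \<lbrakk>hi \<in> private_histories G i D; N \<le> length (fst hi) + m; \<tau> \<in> plans G i D\<rbrakk> \<Longrightarrow>
        plan_value i \<theta>i D \<tau> hi \<le> plan_value i \<theta>i D \<sigma> hi"
      by blast
    define Q where "Q \<rho> hi a = (\<Sum>z | terminal G z \<and> passes i D hi z \<and> the ((z ! length (fst hi)) i) = a.
       gain i \<theta>i z * own_prob i D \<rho> {Suc (length (fst hi))..<length z} z)" for \<rho> hi a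
    define best where "best hi = (SOME a. a \<in> actions G i (fst hi) \<and> (\<forall>b\<in>actions G i (fst hi). Q \<sigma> hi b \<le> Q \<sigma> hi a))" for hi
    \<comment> \<open>Only the layer with \<open>length (fst hi) + Suc m = N\<close> is changed;
      longer histories keep \<open>\<sigma>\<close>, and with it their values.\<close>
    define \<sigma>' where "\<sigma>' hi = (if length (fst hi) + Suc m = N \<and> i \<in> movers G (fst hi) then return_pmf (best hi) else \<sigma> hi)" for hi
    have best: "best (h, l) \<in> actions G i h" "\<And>b. b \<in> actions G i h \<Longrightarrow> Q \<sigma> (h, l) b \<le> Q \<sigma> (h, l) (best (h, l))"
      if hl: "(h, l) \<in> private_histories G i D" "i \<in> movers G h" for h l
    proof -
      obtain b where b: "h @ [b] \<in> histories G" using hl by (auto simp: mem_private_histories)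
      have fin: "finite (Q \<sigma> (h, l) ` actions G i h)" "Q \<sigma> (h, l) ` actions G i h \<noteq> {}"
        using finite_actions[OF b hl(2)] by auto
      obtain a where a: "a \<in> actions G i h" "Q \<sigma> (h, l) a = Max (Q \<sigma> (h, l) ` actions G i h)"
        using Max_in[OF fin] by (metis imageE)
      have "\<exists>a. a \<in> actions G i h \<and> (\<forall>b\<in>actions G i h. Q \<sigma> (h, l) b \<le> Q \<sigma> (h, l) a)"
        using a fin(1) by (intro exI[of _ a]) simp
      from someI_ex[OF this]
      show "best (h, l) \<in> actions G i h" "\<And>b. b \<in> actions G i h \<Longrightarrow> Q \<sigma> (h, l) b \<le> Q \<sigma> (h, l) (best (h, l))"
        by (auto simp: best_def)
    qed
    have \<sigma>': "\<sigma>' \<in> plans G i D"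
      using \<sigma> best(1) unfolding plans_def \<sigma>'_def by (auto split: prod.splits)
    have later: "\<sigma>' (h', l') = \<sigma> (h', l')" if "N < length h' + Suc m" for h' l'
      using that by (simp add: \<sigma>'_def)
    have "plan_value i \<theta>i D \<tau> hi \<le> plan_value i \<theta>i D \<sigma>' hi"
      if hi: "hi \<in> private_histories G i D" "N \<le> length (fst hi) + Suc m" and \<tau>: "\<tau> \<in> plans G i D" for hi \<tau>
    proof (cases "N = length (fst hi) + Suc m")
      case False
      then have "plan_value i \<theta>i D \<sigma>' hi = plan_value i \<theta>i D \<sigma> hi"
        using hi(2) by (intro plan_value_cong later) auto
      then show ?thesis using opt[OF hi(1) _ \<tau>] False hi(2) by simp
    next
      case True
      obtain h l where hl: "hi = (h, l)" by force
      have next_opt: "plan_value i \<theta>i D \<tau> hi' \<le> plan_value i \<theta>i D \<sigma> hi'"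
        if "hi' \<in> private_histories G i D" "length (fst hi') = Suc (length h)" for hi'
        using opt[OF that(1) _ \<tau>] that(2) True by (simp add: hl)
      have \<sigma>\<sigma>': "own_prob i D \<sigma>' {Suc (length h)..<length z} z = own_prob i D \<sigma> {Suc (length h)..<length z} z" for z
        using True by (intro own_prob_cong later) (auto simp: hl)
      show ?thesis
      proof (cases "i \<in> movers G h")
        case False
        show ?thesis
          unfolding hl plan_value_not_mover[OF False] \<sigma>\<sigma>'
          by (rule continuation_value_mono[OF next_opt, where R = "\<lambda>_. True"]) simp_all
      next
        case mover: True
        note hist = hi(1)[unfolded hl]
        obtain b where b: "h @ [b] \<in> histories G" using hist by (auto simp: mem_private_histories)
        have supp: "set_pmf (\<tau> (h, l)) \<subseteq> actions G i h"
          using \<tau> hist mover by (auto simp: plans_def)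
        have "plan_value i \<theta>i D \<tau> (h, l) = (\<Sum>a\<in>actions G i h. pmf (\<tau> (h, l)) a * Q \<tau> (h, l) a)"
          using plan_value_mover[OF mover hist \<tau>, of \<theta>i] by (simp add: Q_def)
        \<comment> \<open>Each action value under \<open>\<tau>\<close> is at most that under
          \<open>\<sigma>\<close>, by the induction hypothesis for the next layer, and the latter is
          at most that of \<open>best\<close>.\<close>
        also have "\<dots> \<le> (\<Sum>a\<in>actions G i h. pmf (\<tau> (h, l)) a * Q \<sigma> (h, l) (best (h, l)))"
        proof (intro sum_mono mult_left_mono)
          fix a assume a: "a \<in> actions G i h"
          have "Q \<tau> (h, l) a \<le> Q \<sigma> (h, l) a"
            unfolding Q_def fst_conv
              by (rule continuation_value_mono[OF next_opt, where R = "\<lambda>s. the (s i) = a"]) simp_all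
          then show "Q \<tau> (h, l) a \<le> Q \<sigma> (h, l) (best (h, l))"
            using best(2)[OF hist mover a] by simp
        qed simp
        also have "\<dots> = Q \<sigma> (h, l) (best (h, l))"
          using sum_pmf_eq_1[OF finite_actions(1)[OF b mover] supp]
          by (simp add: sum_distrib_right[symmetric])
        also have "\<dots> = (\<Sum>a\<in>actions G i h. if a = best (h, l) then Q \<sigma> (h, l) a else 0)"
          using finite_actions(1)[OF b mover] best(1)[OF hist mover] by simp
        also have "\<dots> = (\<Sum>a\<in>actions G i h. pmf (\<sigma>' (h, l)) a * Q \<sigma>' (h, l) a)"
        proof (intro sum.cong refl)
          fix a
          have "Q \<sigma>' (h, l) a = Q \<sigma> (h, l) a" by (simp add: Q_def \<sigma>\<sigma>')
          moreover have "\<sigma>' (h, l) = return_pmf (best (h, l))" using mover True by (simp add: \<sigma>'_def hl)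
          ultimately show "(if a = best (h, l) then Q \<sigma> (h, l) a else 0) = pmf (\<sigma>' (h, l)) a * Q \<sigma>' (h, l) a"
            by simp
        qed
        also have "\<dots> = plan_value i \<theta>i D \<sigma>' (h, l)"
          using plan_value_mover[OF mover hist \<sigma>', of \<theta>i] by (simp add: Q_def)
        finally show ?thesis by (simp add: hl)
      qed
    qed
    then show ?case using \<sigma>' by blast
  qed
  from this[of N] show thesis
    by (auto intro: that)
qed

text \<open>The value before anything is observed, whereas a plan value at \<open>([], l)\<close>
  already fixes the moves that leak in the first stage.\<close>

definition ex_ante_value :: "'i \<Rightarrow> 'q \<Rightarrow> 'i set \<Rightarrow> (('i, 'a) private_history \<Rightarrow> 'a pmf) \<Rightarrow> real" where
  "ex_ante_value i \<theta>i D \<sigma> = (\<Sum>z | terminal G z. gain i \<theta>i z * own_prob i D \<sigma> {0..<length z} z)"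

text \<open>A full observer can imitate a player who observes only \<open>D\<close>. Splice
  \<open>\<sigma>\<close> into the default plan from \<open>(h, l)\<close> on: since the own moves
  of \<open>i\<close> in \<open>h\<close> have positive default probability \<open>c\<close>, the ex
  ante value changes by \<open>c\<close> times the change at \<open>(h, l)\<close>. A profitable
  deviation there would contradict \<open>opt\<close>.\<close>

lemma default_plan_optimal:
  assumes \<theta>i: "\<theta>i \<in> payoff_types M i"
    and opt: "\<And>\<tau>. \<tau> \<in> plans G i (- {i}) \<Longrightarrow>
      ex_ante_value i \<theta>i (- {i}) \<tau> \<le> ex_ante_value i \<theta>i (- {i}) (default_plan i \<theta>i)"
    and hl: "(h, l) \<in> private_histories G i D" and foll: "follows i \<theta>i h"
    and D: "i \<notin> D" and \<sigma>: "\<sigma> \<in> plans G i D"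
  shows "plan_value i \<theta>i D \<sigma> (h, l) \<le> plan_value i \<theta>i D (default_plan i \<theta>i) (h, l)"
proof -
  define n where "n = length h"
  define L where "L = leaked G i D h"
  have L: "i \<notin> L" using D by (simp add: L_def leaked_def)
  have Int: "- {i} \<inter> D = D" "- {i} \<inter> L = L" using D L by auto
  define \<sigma>0 where "\<sigma>0 = default_plan i \<theta>i"
  \<comment> \<open>The private histories of the full observer from \<open>(h, l)\<close> on: later
    public histories that pass through it, and \<open>h\<close> itself if the leaked actions agree
    with \<open>l\<close> on \<open>L\<close>.\<close>
  define beh where "beh h' l' \<longleftrightarrow> (n < length h' \<and> take n h' = h \<and> (h' ! n) |` L = l) \<or> (h' = h \<and> l' |` L = l)" for h' l'
  \<comment> \<open>Restricting \<open>l'\<close> to \<open>D\<close> discards what the full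
    observer sees in excess of \<open>D\<close>.\<close>
  define \<tau> where "\<tau> = (\<lambda>(h', l'). if beh h' l' then \<sigma> (h', l' |` D) else \<sigma>0 (h', l'))"
  have "\<tau> \<in> plans G i (- {i})"
    unfolding plans_def
  proof (safe)
    fix h' l' x assume h': "(h', l') \<in> private_histories G i (- {i})" "i \<in> movers G h'" "x \<in> set_pmf (\<tau> (h', l'))"
    then obtain a where a: "h' @ [a] \<in> histories G" "l' = a |` (- {i})"
      by (auto simp: mem_private_histories leaked_def)
    have "(h', l' |` D) \<in> private_histories G i D"
      using a h'(2) by (auto simp: mem_private_histories leaked_def Int)
    then have "set_pmf (\<sigma> (h', l' |` D)) \<subseteq> actions G i h'"
      using \<sigma> h'(2) by (auto simp: plans_def)
    moreover have "set_pmf (\<sigma>0 (h', l')) \<subseteq> actions G i h'"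
      using default_plan_in_plans[OF \<theta>i, of "- {i}"] h' by (auto simp: plans_def \<sigma>0_def)
    ultimately show "x \<in> actions G i h'"
      using h'(3) by (auto simp: \<tau>_def split: if_splits)
  qed
  then have le: "ex_ante_value i \<theta>i (- {i}) \<tau> \<le> ex_ante_value i \<theta>i (- {i}) \<sigma>0"
    using opt by (simp add: \<sigma>0_def)
  \<comment> \<open>Default plans ignore leaked actions, so the observation set is a dummy
    here.\<close>
  define c where "c = own_prob i {} \<sigma>0 {0..<n} h"
  have c: "c > 0"
    unfolding c_def own_prob_def
  proof (intro prod_pos ballI)
    fix k j assume "k \<in> {0..<n}" "j \<in> movers G (take k h) \<inter> {i}"
    then show "0 < pmf (\<sigma>0 (take k h, (h ! k) |` {})) (the ((h ! k) j))"
      using foll by (auto simp: follows_def n_def pmf_pos \<sigma>0_def default_plan_def)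
  qed
  define P where "P = {z. terminal G z \<and> passes i D (h, l) z}"
  have P: "own_prob i (- {i}) \<rho> {0..<length z} z = c * own_prob i D \<rho>' {n..<length z} z"
    if z: "z \<in> P" and \<rho>: "(\<rho> = \<tau> \<and> \<rho>' = \<sigma>) \<or> (\<rho> = \<sigma>0 \<and> \<rho>' = \<sigma>0)" for z \<rho> \<rho>'
  proof -
    have z': "n < length z" "take n z = h" "(z ! n) |` L = l"
      using z by (auto simp: P_def passes_def n_def L_def)
    have hk: "take k h = take k z" "h ! k = z ! k" if "k < n" for k
      using that z'(2) by (auto simp: min_def)
    have "own_prob i (- {i}) \<rho> {0..<n} z = own_prob i {} \<sigma>0 {0..<n} z"
    proof (rule own_prob_cong)
      fix k assume k: "k \<in> {0..<n}"
      have "length (take k z) < n" using k z'(1) by simp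
      then have "\<not> beh (take k z) ((z ! k) |` (- {i}))"
        by (auto simp: beh_def n_def)
      then show "\<rho> (take k z, (z ! k) |` (- {i})) = \<sigma>0 (take k z, (z ! k) |` {})"
        using \<rho> by (auto simp: \<tau>_def \<sigma>0_def default_plan_def)
    qed
    also have "\<dots> = c"
      unfolding c_def own_prob_def by (intro prod.cong refl) (auto simp: hk)
    finally have 1: "own_prob i (- {i}) \<rho> {0..<n} z = c" .
    have 2: "own_prob i (- {i}) \<rho> {n..<length z} z = own_prob i D \<rho>' {n..<length z} z"
    proof (rule own_prob_cong)
      fix k assume k: "k \<in> {n..<length z}"
      have "beh (take k z) ((z ! k) |` (- {i}))"
        using k z' by (cases "k = n") (auto simp: beh_def min_def Int)
      then show "\<rho> (take k z, (z ! k) |` (- {i})) = \<rho>' (take k z, (z ! k) |` D)"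
        using \<rho> by (auto simp: \<tau>_def \<sigma>0_def default_plan_def Int)
    qed
    show ?thesis
      using own_prob_split[of 0 n "length z" i "- {i}" \<rho> z] z'(1) 1 2 by simp
  qed
  have P\<tau>: "own_prob i (- {i}) \<tau> {0..<length z} z = c * own_prob i D \<sigma> {n..<length z} z"
    and P\<sigma>0: "own_prob i (- {i}) \<sigma>0 {0..<length z} z = c * own_prob i D \<sigma>0 {n..<length z} z"
    if "z \<in> P" for z
    by (rule P[OF that], simp)+
  have nP: "own_prob i (- {i}) \<tau> {0..<length z} z = own_prob i (- {i}) \<sigma>0 {0..<length z} z"
    if z: "terminal G z" "z \<notin> P" for z
  proof (rule own_prob_cong)
    fix k assume k: "k \<in> {0..<length z}"
    have "\<not> beh (take k z) ((z ! k) |` (- {i}))"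
      using k z by (auto simp: beh_def P_def passes_def n_def L_def Int[unfolded L_def] min_def split: if_splits)
    then show "\<tau> (take k z, (z ! k) |` (- {i})) = \<sigma>0 (take k z, (z ! k) |` (- {i}))"
      by (simp add: \<tau>_def)
  qed
  have sub: "P \<subseteq> {z. terminal G z}" by (auto simp: P_def)
  have "ex_ante_value i \<theta>i (- {i}) \<tau> =
      (\<Sum>z\<in>{z. terminal G z} - P. gain i \<theta>i z * own_prob i (- {i}) \<sigma>0 {0..<length z} z) +
      c * plan_value i \<theta>i D \<sigma> (h, l)"
    unfolding ex_ante_value_def sum.subset_diff[OF sub finite_terminal] plan_value_def fst_conv
      P_def[symmetric] n_def[symmetric] sum_distrib_left
    by (intro arg_cong2[where f = "(+)"] sum.cong refl) (auto simp: nP P\<tau>)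
  moreover have "ex_ante_value i \<theta>i (- {i}) \<sigma>0 =
      (\<Sum>z\<in>{z. terminal G z} - P. gain i \<theta>i z * own_prob i (- {i}) \<sigma>0 {0..<length z} z) +
      c * plan_value i \<theta>i D \<sigma>0 (h, l)"
    unfolding ex_ante_value_def sum.subset_diff[OF sub finite_terminal] plan_value_def fst_conv
      P_def[symmetric] n_def[symmetric] sum_distrib_left
    by (intro arg_cong2[where f = "(+)"] sum.cong refl) (auto simp: P\<sigma>0)
  ultimately have "c * plan_value i \<theta>i D \<sigma> (h, l) \<le> c * plan_value i \<theta>i D \<sigma>0 (h, l)"
    using le by simp
  then show ?thesis using c by (simp add: \<sigma>0_def)
qed

section \<open>Ex ante values\<close>

text \<open>Invariant in \<open>m\<close>: the weight of the terminal histories shorter than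
  \<open>m\<close> plus that of all histories of length \<open>m\<close> is one, because extending
  nonterminal histories by a stage preserves weight. For \<open>m\<close> beyond all lengths only
  the terminal histories are left.\<close>

lemma sum_terminal_eq_1:
  fixes w :: "('i, 'a) history \<Rightarrow> ('i \<rightharpoonup> 'a) \<Rightarrow> real"
  assumes w: "\<And>h b. h @ [b] \<in> histories G \<Longrightarrow> (\<Sum>a | h @ [a] \<in> histories G. w h a) = 1"
  shows "(\<Sum>z | terminal G z. \<Prod>k<length z. w (take k z) (z ! k)) = 1"
proof -
  define W where "W h = (\<Prod>k<length h. w (take k h) (h ! k))" for h
  define X where "X m = {h. terminal G h \<and> length h < m}" for m
  define Y where "Y m = {h \<in> histories G. length h = m}" for m
  have fin: "finite (X m)" "finite (Y m)" for m
    using finite_terminal finite_histories by (auto simp: X_def Y_def)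
  have W_snoc: "W (h @ [a]) = W h * w h a" for h a
    by (simp add: W_def nth_append)
  have fin_stages: "finite {a. h @ [a] \<in> histories G}" for h
  proof (rule finite_subset)
    show "{a. h @ [a] \<in> histories G} \<subseteq> last ` histories G" by force
  qed (use finite_histories in simp)
  have Y_Suc: "(\<Sum>h\<in>Y (Suc m). W h) = (\<Sum>h\<in>{h \<in> Y m. \<not> terminal G h}. W h)" for m
  proof -
    have "(\<Sum>h\<in>Y (Suc m). W h) = (\<Sum>(h, a)\<in>(SIGMA h:{h \<in> Y m. \<not> terminal G h}. {a. h @ [a] \<in> histories G}). W h * w h a)"
    proof (rule sum.reindex_bij_witness[where i = "\<lambda>(h, a). h @ [a]" and j = "\<lambda>h. (butlast h, last h)"])
      fix h assume h: "h \<in> Y (Suc m)"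
      then have "h \<noteq> []" by (auto simp: Y_def)
      then have h': "butlast h @ [last h] = h" by simp
      then show "(\<lambda>(h, a). h @ [a]) (butlast h, last h) = h" by simp
      have "butlast h @ [last h] \<in> histories G" using h h' by (simp add: Y_def)
      then show "(butlast h, last h) \<in> (SIGMA h:{h \<in> Y m. \<not> terminal G h}. {a. h @ [a] \<in> histories G})"
        using h snoc_history by (auto simp: Y_def terminal_def)
      show "(\<lambda>(h, a). W h * w h a) (butlast h, last h) = W h"
        using W_snoc[of "butlast h" "last h"] h' by simp
    qed (auto simp: Y_def)
    also have "\<dots> = (\<Sum>h\<in>{h \<in> Y m. \<not> terminal G h}. W h * (\<Sum>a | h @ [a] \<in> histories G. w h a))"
      by (subst sum.Sigma[symmetric]) (auto simp: fin fin_stages sum_distrib_left)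
    also have "\<dots> = (\<Sum>h\<in>{h \<in> Y m. \<not> terminal G h}. W h)"
      using w by (intro sum.cong refl) (auto simp: Y_def terminal_def)
    finally show ?thesis .
  qed
  have "(\<Sum>h\<in>X m. W h) + (\<Sum>h\<in>Y m. W h) = 1" for m
  proof (induction m)
    case 0
    have "X 0 = {}" "Y 0 = {[]}" using Nil_history by (auto simp: X_def Y_def)
    then show ?case by (simp add: W_def)
  next
    case (Suc m)
    have "X (Suc m) = X m \<union> {h \<in> Y m. terminal G h}" "X m \<inter> {h \<in> Y m. terminal G h} = {}"
      using terminal_history by (auto simp: X_def Y_def)
    then have "(\<Sum>h\<in>X (Suc m). W h) = (\<Sum>h\<in>X m. W h) + (\<Sum>h\<in>{h \<in> Y m. terminal G h}. W h)"
      using fin by (simp add: sum.union_disjoint)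
    moreover have "(\<Sum>h\<in>Y m. W h) = (\<Sum>h\<in>{h \<in> Y m. terminal G h}. W h) + (\<Sum>h\<in>{h \<in> Y m. \<not> terminal G h}. W h)"
      using fin by (subst sum.union_disjoint[symmetric]) (auto intro!: sum.cong)
    ultimately show ?case using Suc Y_Suc by simp
  qed
  note total = this
  define m where "m = Suc (Max (length ` histories G))"
  have m: "length h < m" if "h \<in> histories G" for h
    using that finite_histories by (auto simp: m_def less_Suc_eq_le)
  have "X m = {z. terminal G z}" "Y m = {}"
    using m terminal_history by (auto simp: X_def Y_def)
  then have "(\<Sum>z | terminal G z. W z) = 1"
    using total[of m] by simp
  then show ?thesis
    by (simp add: W_def)
qed

text \<open>The action of \<open>i\<close> may depend on all concurrent moves of the others, so the
  joint distribution need not be a product. Summing first over the action of \<open>i\<close>, given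
  the others' moves, leaves the product distribution of the others.\<close>

lemma sum_stage_prob:
  assumes b: "h @ [b] \<in> histories G" and \<sigma>: "\<sigma> \<in> plans G i (- {i})"
    and \<theta>: "\<theta> \<in> PiE (- {i}) (payoff_types M)"
  shows "(\<Sum>a | h @ [a] \<in> histories G. (\<Prod>j\<in>movers G h - {i}. pmf (S0 j (\<theta> j) h) (the (a j))) *
    (\<Prod>j\<in>movers G h \<inter> {i}. pmf (\<sigma> (h, a |` (- {i}))) (the (a j)))) = 1"
proof -
  define J where "J = movers G h - {i}"
  have *: "finite (actions G j h) \<and> set_pmf (S0 j (\<theta> j) h) \<subseteq> actions G j h" if "j \<in> J" for j
    using that finite_actions[OF b, of j] S0_actions[OF _ b, of "\<theta> j" j] \<theta> by (auto simp: J_def)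
  have 1: "(\<Sum>a\<in>stage_maps J (\<lambda>j. actions G j h). \<Prod>j\<in>J. pmf (S0 j (\<theta> j) h) (the (a j))) = 1"
    by (rule sum_stage_maps_prod_pmf) (simp_all add: *)
  show ?thesis
  proof (cases "i \<in> movers G h")
    case False
    then have "movers G h - {i} = J" "movers G h \<inter> {i} = {}" "movers G h = J" by (auto simp: J_def)
    then show ?thesis using 1 by (simp add: stages_eq[OF b])
  next
    case True
    then have m: "movers G h = insert i J" "movers G h \<inter> {i} = {i}" "i \<notin> J" by (auto simp: J_def)
    have "(\<Sum>a\<in>stage_maps (insert i J) (\<lambda>j. actions G j h). (\<Prod>j\<in>J. pmf (S0 j (\<theta> j) h) (the (a j))) *
        pmf (\<sigma> (h, a |` (- {i}))) (the (a i))) =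
      (\<Sum>a\<in>stage_maps (insert i J) (\<lambda>j. actions G j h). (\<Prod>j\<in>J. pmf (S0 j (\<theta> j) h) (the ((a |` (- {i})) j))) *
        pmf (\<sigma> (h, a |` (- {i}))) (the (a i)))"
      using m(3) by (intro sum.cong refl arg_cong2[where f = "(*)"] prod.cong) (auto simp: restrict_map_def)
    also have "\<dots> = (\<Sum>a\<in>stage_maps J (\<lambda>j. actions G j h). \<Sum>x\<in>actions G i h.
        (\<Prod>j\<in>J. pmf (S0 j (\<theta> j) h) (the (a j))) * pmf (\<sigma> (h, a)) x)"
      by (rule sum_stage_maps_insert[OF m(3)])
    also have "\<dots> = (\<Sum>a\<in>stage_maps J (\<lambda>j. actions G j h). \<Prod>j\<in>J. pmf (S0 j (\<theta> j) h) (the (a j)))"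
    proof (intro sum.cong refl)
      fix a assume a: "a \<in> stage_maps J (\<lambda>j. actions G j h)"
      \<comment> \<open>Any \<open>x\<close> completes \<open>a\<close> to a stage of the game; so
        \<open>(h, a)\<close> is a private history, at which \<open>\<sigma>\<close> is supported on
        feasible actions.\<close>
      obtain x where x: "x \<in> actions G i h" using finite_actions(2)[OF b True] by blast
      have "a(i \<mapsto> x) \<in> stage_maps (movers G h) (\<lambda>j. actions G j h)"
        using a x by (auto simp: stage_maps_def m(1))
      then have "h @ [a(i \<mapsto> x)] \<in> histories G" using snoc_history_iff[OF b] by blast
      moreover have "a = a(i \<mapsto> x) |` leaked G i (- {i}) h"
        using a m(3) True by (auto simp: leaked_def restrict_map_def fun_eq_iff stage_maps_def)
      ultimately have "(h, a) \<in> private_histories G i (- {i})"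
        unfolding mem_private_histories by blast
      then have "set_pmf (\<sigma> (h, a)) \<subseteq> actions G i h"
        using \<sigma> True by (auto simp: plans_def)
      then show "(\<Sum>x\<in>actions G i h. (\<Prod>j\<in>J. pmf (S0 j (\<theta> j) h) (the (a j))) * pmf (\<sigma> (h, a)) x) =
          (\<Prod>j\<in>J. pmf (S0 j (\<theta> j) h) (the (a j)))"
        using sum_pmf_eq_1[OF finite_actions(1)[OF b True]] by (simp add: sum_distrib_left[symmetric])
    qed
    finally show ?thesis
      using 1 unfolding stages_eq[OF b] J_def[symmetric] m(2) by (simp add: m(1))
  qed
qed

lemma sum_play_prob:
  assumes \<sigma>: "\<sigma> \<in> plans G i (- {i})" and \<theta>: "\<theta> \<in> PiE (- {i}) (payoff_types M)"
  shows "(\<Sum>z | terminal G z. others_prob i \<theta> z * own_prob i (- {i}) \<sigma> {0..<length z} z) = 1"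
proof -
  have "others_prob i \<theta> z * own_prob i (- {i}) \<sigma> {0..<length z} z =
      (\<Prod>k<length z. (\<Prod>j\<in>movers G (take k z) - {i}. pmf (S0 j (\<theta> j) (take k z)) (the ((z ! k) j))) *
        (\<Prod>j\<in>movers G (take k z) \<inter> {i}. pmf (\<sigma> (take k z, (z ! k) |` (- {i}))) (the ((z ! k) j))))" for z
    by (simp add: others_prob_def own_prob_def prod.distrib atLeast0LessThan)
  then show ?thesis
    using sum_terminal_eq_1[OF sum_stage_prob[OF _ \<sigma> \<theta>]] by simp
qed

text \<open>The right-hand side does not mention \<open>\<sigma>\<close>: any two plans that lead to
  \<open>f\<close> against the default strategies have the same ex ante value. For each
  \<open>\<theta>\<close> the probabilities of play sum to one, so the utility of \<open>f\<close>
  can be pulled out of the sum over terminal histories.\<close>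

lemma ex_ante_value_implementing:
  assumes \<sigma>: "\<sigma> \<in> plans G i (- {i})"
    and f: "\<And>\<theta> z. \<lbrakk>\<theta> \<in> PiE (- {i}) (payoff_types M); terminal G z;
      others_prob i \<theta> z * own_prob i (- {i}) \<sigma> {0..<length z} z \<noteq> 0\<rbrakk> \<Longrightarrow> outcome G z = f (\<theta>(i := \<theta>i))"
  shows "ex_ante_value i \<theta>i (- {i}) \<sigma> =
    measure_pmf.expectation (others_prior i) (\<lambda>\<theta>. utility M i (f (\<theta>(i := \<theta>i))) (\<theta>(i := \<theta>i)))"
proof -
  define I where "I = set_pmf (others_prior i)"
  define p where "p = pmf (others_prior i)"
  note E = finite_support_expectation[OF finite_others_prior order_refl]
  have "ex_ante_value i \<theta>i (- {i}) \<sigma> = (\<Sum>z | terminal G z. \<Sum>\<theta>\<in>I. p \<theta> *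
      (utility M i (outcome G z) (\<theta>(i := \<theta>i)) * (others_prob i \<theta> z * own_prob i (- {i}) \<sigma> {0..<length z} z)))"
    unfolding ex_ante_value_def gain_def E I_def[symmetric] p_def[symmetric] sum_distrib_right
    by (simp add: mult.assoc)
  also have "\<dots> = (\<Sum>\<theta>\<in>I. \<Sum>z | terminal G z. p \<theta> *
      (utility M i (outcome G z) (\<theta>(i := \<theta>i)) * (others_prob i \<theta> z * own_prob i (- {i}) \<sigma> {0..<length z} z)))"
    by (rule sum.swap)
  also have "\<dots> = (\<Sum>\<theta>\<in>I. \<Sum>z | terminal G z. p \<theta> *
      (utility M i (f (\<theta>(i := \<theta>i))) (\<theta>(i := \<theta>i)) * (others_prob i \<theta> z * own_prob i (- {i}) \<sigma> {0..<length z} z)))"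
  proof (intro sum.cong refl)
    fix \<theta> z assume "\<theta> \<in> I" "z \<in> {z. terminal G z}"
    then have "outcome G z = f (\<theta>(i := \<theta>i)) \<or> others_prob i \<theta> z * own_prob i (- {i}) \<sigma> {0..<length z} z = 0"
      using f[of \<theta> z] unfolding I_def set_others_prior by blast
    then show "p \<theta> * (utility M i (outcome G z) (\<theta>(i := \<theta>i)) *
        (others_prob i \<theta> z * own_prob i (- {i}) \<sigma> {0..<length z} z)) =
      p \<theta> * (utility M i (f (\<theta>(i := \<theta>i))) (\<theta>(i := \<theta>i)) *
        (others_prob i \<theta> z * own_prob i (- {i}) \<sigma> {0..<length z} z))"
      by (elim disjE) (simp_all only: mult_zero_right)
  qed
  also have "\<dots> = (\<Sum>\<theta>\<in>I. p \<theta> * utility M i (f (\<theta>(i := \<theta>i))) (\<theta>(i := \<theta>i)))"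
  proof (intro sum.cong refl)
    fix \<theta> assume "\<theta> \<in> I"
    then show "(\<Sum>z | terminal G z. p \<theta> *
      (utility M i (f (\<theta>(i := \<theta>i))) (\<theta>(i := \<theta>i)) * (others_prob i \<theta> z * own_prob i (- {i}) \<sigma> {0..<length z} z))) =
      p \<theta> * utility M i (f (\<theta>(i := \<theta>i))) (\<theta>(i := \<theta>i))"
      using sum_play_prob[OF \<sigma>, of \<theta>] unfolding I_def set_others_prior
      by (simp add: sum_distrib_left[symmetric])
  qed
  finally show ?thesis by (simp add: E I_def p_def)
qed

text \<open>The ex ante value is the plain sum of the plan values over what may leak in the first
  stage; plan values are not normalised, so no weights appear. If the empty history is terminal, it
  contributes a constant.\<close>

lemma ex_ante_value_mono:
  assumes le: "\<And>l. ([], l) \<in> private_histories G i D \<Longrightarrow>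
      plan_value i \<theta>i D \<tau> ([], l) \<le> plan_value i \<theta>i D \<sigma> ([], l)"
  shows "ex_ante_value i \<theta>i D \<tau> \<le> ex_ante_value i \<theta>i D \<sigma>"
proof -
  define Z where "Z = {z. terminal G z \<and> z \<noteq> []}"
  define key where "key z = (z ! 0) |` leaked G i D []" for z :: "('i, 'a) history"
  have fin: "finite Z" using finite_terminal by (auto simp: Z_def)
  have "ex_ante_value i \<theta>i D \<rho> = (\<Sum>z\<in>{z. terminal G z} - Z. gain i \<theta>i z) +
      (\<Sum>l\<in>key ` Z. plan_value i \<theta>i D \<rho> ([], l))" for \<rho>
  proof -
    have "(\<Sum>z\<in>Z. gain i \<theta>i z * own_prob i D \<rho> {0..<length z} z) =
        (\<Sum>l\<in>key ` Z. plan_value i \<theta>i D \<rho> ([], l))"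
    proof (subst sum.image_gen[OF fin, of _ key], intro sum.cong refl)
      fix l
      have "{z \<in> Z. key z = l} = {z. terminal G z \<and> passes i D ([], l) z}"
        by (auto simp: Z_def key_def passes_def)
      then show "(\<Sum>z\<in>{z \<in> Z. key z = l}. gain i \<theta>i z * own_prob i D \<rho> {0..<length z} z) =
          plan_value i \<theta>i D \<rho> ([], l)"
        by (simp add: plan_value_def)
    qed
    moreover have "own_prob i D \<rho> {0..<length z} z = 1" if "z \<in> {z. terminal G z} - Z" for z
      using that by (simp add: own_prob_def Z_def)
    ultimately show ?thesis
      unfolding ex_ante_value_def using finite_terminal
      by (subst sum.subset_diff[of Z]) (auto simp: Z_def)
  qed
  moreover have "([], l) \<in> private_histories G i D" if l: "l \<in> key ` Z" for l
  proof -
    obtain z where "z \<in> Z" "l = key z" using l by blast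
    then show ?thesis
      using take_snoc_history[of z 0] terminal_history unfolding mem_private_histories Z_def key_def by auto
  qed
  ultimately show ?thesis
    using le by (simp add: sum_mono)
qed

end

section \<open>Leakage-proofness\<close>

lemma reach_prob_cong:
  assumes "\<And>k j. \<lbrakk>k < length z; j \<in> movers G (take k z)\<rbrakk> \<Longrightarrow>
    \<sigma> j (take k z, (z ! k) |` D j) = \<sigma>' j (take k z, (z ! k) |` D' j)"
  shows "reach_prob G D \<sigma> z = reach_prob G D' \<sigma>' z"
  using assms by (auto simp: reach_prob_def stage_prob_def intro!: prod.cong)

lemma reach_prob_nonneg: "0 \<le> reach_prob G D \<sigma> z"
  by (auto simp: reach_prob_def stage_prob_def intro!: prod_nonneg)

section \<open>Observation sets and realizable profiles\<close>

lemma observed_zero_type: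
  assumes "type_belief T i ti = return_pmf (all_equal, t)"
  shows "observed T i ti = {}"
  using assms by (simp add: observed_def possible_orders_def slower_def all_equal_def)

lemma observed_fastest_type:
  assumes "type_belief T i ti = return_pmf (fastest i, t)"
  shows "observed T i ti = - {i}"
  using assms by (auto simp: observed_def possible_orders_def slower_def fastest_def)

lemma observed_eq_slower:
  assumes "consistent T r t"
  shows "observed T i (t i) = slower r i"
proof -
  have "possible_orders T i (t i) \<noteq> {}"
    by (simp add: possible_orders_def set_pmf_not_empty)
  moreover have "slower r' i = slower r i" if "r' \<in> possible_orders T i (t i)" for r'
    using assms that unfolding consistent_def consistent_orders_def by blast
  ultimately show ?thesis
    unfolding observed_def by auto
qed

text \<open>Makes the cardinality of \<open>slower r j\<close> a rank that increases strictly from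
  slower to faster players, on which the induction within a stage runs.\<close>

lemma slower_psubset:
  assumes "r \<in> leakage_orders" "k \<in> slower r j"
  shows "slower r k \<subset> slower r j"
proof -
  have tr: "trans r" using assms by (simp add: leakage_orders_def)
  have "slower r k \<subseteq> slower r j"
    using assms(2) tr unfolding slower_def by (blast dest: transD)
  moreover have "k \<notin> slower r k" by (simp add: slower_def)
  ultimately show ?thesis using assms(2) by blast
qed

lemma consistent_zero_profile:
  assumes "zero_profile T t0"
  shows "consistent T all_equal t0"
  using assms by (auto simp: consistent_def zero_profile_def possible_orders_def leakage_orders_def
      consistent_orders_def all_equal_def trans_def)

text \<open>For \<open>j \<noteq> i\<close> nobody is slower than \<open>j\<close> under either
  \<open>fastest i\<close> or \<open>all_equal\<close>. So the zero-types of the others remain right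
  about whom they observe, although \<open>i\<close> now observes them.\<close>

lemma consistent_one_profile:
  assumes "zero_profile T t0" "type_belief T i ti = return_pmf (fastest i, t)"
  shows "consistent T (fastest i) (t0(i := ti))"
proof -
  have "possible_orders T j ((t0(i := ti)) j) \<subseteq> consistent_orders j (fastest i)" for j
    using assms by (cases "j = i") (auto simp: zero_profile_def possible_orders_def leakage_orders_def
      consistent_orders_def all_equal_def fastest_def slower_def trans_def)
  moreover have "fastest i \<in> leakage_orders"
    by (auto simp: leakage_orders_def fastest_def trans_def)
  ultimately show ?thesis by (simp add: consistent_def)
qed

lemma default_play_if_default_PBE:
  assumes "valid_payoffs M" "multistage_game M G" "default_PBE M G S0 \<mu>0"
  shows "default_play M G S0"
proof
  fix \<theta>i i h a
  assume \<theta>i: "\<theta>i \<in> payoff_types M i" and h: "h @ [a] \<in> histories G" "i \<in> movers G h"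
  define l where "l = a |` leaked G i (observed no_leakage i ()) h"
  have hl: "(h, l) \<in> private_histories G i (observed no_leakage i ())"
    using h unfolding mem_private_histories l_def by blast
  then have "lift_strategies S0 i \<theta>i () \<in> plans G i (observed no_leakage i ())"
    using assms(3) \<theta>i by (auto simp: default_PBE_def PBE_def no_leakage_def is_arg_max_def)
  then show "set_pmf (S0 i \<theta>i h) \<subseteq> actions G i h"
    using hl h(2) by (auto simp: plans_def lift_strategies_def)
qed fact+

context default_play
begin

section \<open>Ex ante optimality of the default plan\<close>

lemma reach_prob_eq:
  assumes "\<And>k j. \<lbrakk>k < length z; j \<in> movers G (take k z); j \<noteq> i\<rbrakk> \<Longrightarrow>
    \<sigma> j (take k z, (z ! k) |` D j) = S0 j (\<theta> j) (take k z)"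
  shows "reach_prob G D \<sigma> z = others_prob i \<theta> z * own_prob i (D i) (\<sigma> i) {0..<length z} z"
proof -
  have "reach_prob G D \<sigma> z = (\<Prod>k<length z. stage_prob D \<sigma> (movers G (take k z) - {i}) (take k z) (z ! k) *
      stage_prob D \<sigma> (movers G (take k z) \<inter> {i}) (take k z) (z ! k))"
    unfolding reach_prob_def by (intro prod.cong refl stage_prob_split)
  also have "\<dots> = others_prob i \<theta> z * own_prob i (D i) (\<sigma> i) {0..<length z} z"
    unfolding others_prob_def own_prob_def prod.distrib stage_prob_def atLeast0LessThan
    using assms by (intro arg_cong2[where f = "(*)"] prod.cong refl) auto
  finally show ?thesis .
qed

lemma terminal_take:
  assumes "terminal G z" "k < length z"
  shows "take k z \<in> histories G" "\<not> terminal G (take k z)"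
  using take_snoc_history[OF terminal_history[OF assms(1)] assms(2)] snoc_history
  by (auto simp: terminal_def)

text \<open>If there is no private history, \<open>PBE\<close> says nothing about the strategy, but
  then \<open>plans\<close> contains every function.\<close>

lemma PBE_strategy_in_plans:
  assumes "PBE M G T S \<mu>" "\<theta>i \<in> payoff_types M i" "ti \<in> leakage_types T i"
  shows "S i \<theta>i ti \<in> plans G i (observed T i ti)"
proof (cases "private_histories G i (observed T i ti) = {}")
  case False
  then show ?thesis
    using assms unfolding PBE_def is_arg_max_def by blast
qed (simp add: plans_def)

text \<open>In the zero-profile nothing leaks and everybody plays \<open>S0\<close>, so terminal
  histories have the same probability as in the default game. The zero-profile is realizable, so
  \<open>yields\<close> applies to it.\<close>

lemma default_yields_if_default_part:
  assumes yields: "yields M G T S f" and rich: "minimally_rich T t0"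
    and part: "\<And>i \<theta>i h. \<lbrakk>\<theta>i \<in> payoff_types M i; h \<in> histories G; \<not> terminal G h; i \<in> movers G h\<rbrakk> \<Longrightarrow>
      S0 i \<theta>i h = S i \<theta>i (t0 i) (h, Map.empty)"
  shows "default_yields M G S0 f"
  unfolding default_yields_def yields_def
proof (intro ballI impI allI; elim conjE)
  fix \<theta> t z
  assume \<theta>: "\<theta> \<in> payoff_profiles M" and z: "terminal G z"
    and pos: "0 < reach_prob G (observed_profile no_leakage t) (\<lambda>j. lift_strategies S0 j (\<theta> j) (t j)) z"
  have t0: "zero_profile T t0" using rich by (simp add: minimally_rich_def)
  have "reach_prob G (observed_profile T t0) (\<lambda>j. S j (\<theta> j) (t0 j)) z =
      reach_prob G (observed_profile no_leakage t) (\<lambda>j. lift_strategies S0 j (\<theta> j) (t j)) z"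
  proof (rule reach_prob_cong)
    fix k j assume k: "k < length z" "j \<in> movers G (take k z)"
    have "observed T j (t0 j) = {}"
      using t0 by (intro observed_zero_type) (simp add: zero_profile_def)
    moreover have "\<theta> j \<in> payoff_types M j" using \<theta> by (simp add: payoff_profiles_def)
    ultimately show "S j (\<theta> j) (t0 j) (take k z, (z ! k) |` observed_profile T t0 j) =
        lift_strategies S0 j (\<theta> j) (t j) (take k z, (z ! k) |` observed_profile no_leakage t j)"
      using part[of "\<theta> j" j "take k z"] terminal_take[OF z k(1)] k(2)
      by (simp add: observed_profile_def lift_strategies_def)
  qed
  moreover have "t0 \<in> leakage_profiles T" "realizable T t0"
    using t0 consistent_zero_profile[OF t0] by (auto simp: zero_profile_def realizable_def)
  ultimately show "outcome G z = f \<theta>"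
    using yields \<theta> z pos unfolding yields_def by simp
qed

text \<open>
  The one-profile in which \<open>i\<close> observes everybody else, who play the default strategies, yields \<open>f\<close>
  as well.  So observing the others' concurrent actions is worth nothing to \<open>i\<close>.
\<close>

lemma default_plan_ex_ante_optimal:
  assumes pruned: "pruned M G S0" and feas: "feasible T" and PBE: "PBE M G T S \<mu>"
    and yields: "yields M G T S f" and rich: "minimally_rich T t0"
    and part: "\<And>i \<theta>i h. \<lbrakk>\<theta>i \<in> payoff_types M i; h \<in> histories G; \<not> terminal G h; i \<in> movers G h\<rbrakk> \<Longrightarrow>
      S0 i \<theta>i h = S i \<theta>i (t0 i) (h, Map.empty)"
    and \<theta>i: "\<theta>i \<in> payoff_types M i" and \<tau>: "\<tau> \<in> plans G i (- {i})"
  shows "ex_ante_value i \<theta>i (- {i}) \<tau> \<le> ex_ante_value i \<theta>i (- {i}) (default_plan i \<theta>i)"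
proof -
  have t0: "zero_profile T t0" using rich by (simp add: minimally_rich_def)
  obtain ti where ti: "ti \<in> leakage_types T i"
    and bel: "type_belief T i ti = return_pmf (fastest i, restrict t0 (- {i}))"
    using rich by (auto simp: minimally_rich_def)
  note obs_i = observed_fastest_type[OF bel]
  have obs: "observed T j (t0 j) = {}" for j
    using t0 by (intro observed_zero_type) (simp add: zero_profile_def)
  \<comment> \<open>The belief of \<open>ti\<close> is concentrated on the zero-types of the others,
    who observe nothing and play \<open>S0\<close> wherever they move.\<close>
  have comp: "compliant T S i ti"
    unfolding compliant_def
  proof (intro ballI allI impI; elim conjE)
    fix t j \<theta>j h a l
    assume t: "t \<in> snd ` set_pmf (type_belief T i ti)" and j: "j \<noteq> i" "\<theta>j \<in> payoff_types M j" "j \<in> movers G h"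
      and h: "h @ [a] \<in> histories G"
    have "t j = t0 j" using t j(1) by (simp add: bel)
    moreover have "h \<in> histories G" "\<not> terminal G h"
      using h snoc_history by (auto simp: terminal_def)
    ultimately show "S j \<theta>j (t j) (h, l |` observed T j (t j)) = S0 j \<theta>j h"
      using part j by (simp add: obs)
  qed
  define \<sigma> where "\<sigma> = S i \<theta>i ti"
  have \<sigma>: "\<sigma> \<in> plans G i (- {i})"
    using PBE_strategy_in_plans[OF PBE \<theta>i ti] by (simp add: \<sigma>_def obs_i)
  \<comment> \<open>Sequential rationality of \<open>ti\<close> at the first stage, for each
    possible leak \<open>l\<close>, adds up to an ex ante inequality.\<close>
  have "ex_ante_value i \<theta>i (- {i}) \<tau> \<le> ex_ante_value i \<theta>i (- {i}) \<sigma>"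
  proof (rule ex_ante_value_mono)
    fix l assume l: "([], l) \<in> private_histories G i (- {i})"
    then have l': "([], l) \<in> private_histories G i (observed T i ti)" by (simp add: obs_i)
    have bayes: "bayes_consistent M G T S \<mu> i ti ([], l)"
      and opt: "is_arg_max (expected_utility M G T S \<mu> i \<theta>i ti ([], l)) (\<lambda>\<sigma>i. \<sigma>i \<in> plans G i (observed T i ti)) (S i \<theta>i ti)"
      using PBE ti l' \<theta>i unfolding PBE_def by blast+
    have "expected_utility M G T S \<mu> i \<theta>i ti ([], l) \<tau> \<le> expected_utility M G T S \<mu> i \<theta>i ti ([], l) \<sigma>"
      using opt \<tau> by (auto simp: is_arg_max_def obs_i \<sigma>_def not_less)
    moreover have "total_likelihood i (- {i}) ([], l) > 0"
      by (rule total_likelihood_pos[OF pruned l]) simp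
    ultimately show "plan_value i \<theta>i (- {i}) \<tau> ([], l) \<le> plan_value i \<theta>i (- {i}) \<sigma> ([], l)"
      unfolding expected_utility_eq[OF comp finite_type_belief[OF feas ti] pruned l' bayes] obs_i
      by (simp add: divide_le_cancel)
  qed
  also have "\<dots> = measure_pmf.expectation (others_prior i) (\<lambda>\<theta>. utility M i (f (\<theta>(i := \<theta>i))) (\<theta>(i := \<theta>i)))"
  proof (rule ex_ante_value_implementing[OF \<sigma>])
    fix \<theta> z
    assume \<theta>: "\<theta> \<in> PiE (- {i}) (payoff_types M)" and z: "terminal G z"
      and nz: "others_prob i \<theta> z * own_prob i (- {i}) \<sigma> {0..<length z} z \<noteq> 0"
    define \<theta>' where "\<theta>' = \<theta>(i := \<theta>i)"
    define t where "t = t0(i := ti)"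
    have \<theta>': "\<theta>' \<in> payoff_profiles M" using \<theta> \<theta>i by (auto simp: payoff_profiles_def \<theta>'_def)
    have t: "t \<in> leakage_profiles T" "realizable T t"
      using t0 ti consistent_one_profile[OF t0 bel] by (auto simp: zero_profile_def leakage_profiles_def realizable_def t_def)
    have "reach_prob G (observed_profile T t) (\<lambda>j. S j (\<theta>' j) (t j)) z =
        others_prob i \<theta> z * own_prob i (observed_profile T t i) (S i (\<theta>' i) (t i)) {0..<length z} z"
    proof (rule reach_prob_eq)
      fix k j assume k: "k < length z" "j \<in> movers G (take k z)" "j \<noteq> i"
      have "\<theta> j \<in> payoff_types M j" using \<theta> k(3) by auto
      then show "S j (\<theta>' j) (t j) (take k z, (z ! k) |` observed_profile T t j) = S0 j (\<theta> j) (take k z)"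
        using part[of "\<theta> j" j "take k z"] terminal_take[OF z k(1)] k
        by (simp add: observed_profile_def obs \<theta>'_def t_def)
    qed
    then have "reach_prob G (observed_profile T t) (\<lambda>j. S j (\<theta>' j) (t j)) z \<noteq> 0"
      using nz by (simp add: observed_profile_def obs_i t_def \<theta>'_def \<sigma>_def)
    then have "reach_prob G (observed_profile T t) (\<lambda>j. S j (\<theta>' j) (t j)) z > 0"
      using reach_prob_nonneg[of G "observed_profile T t" "\<lambda>j. S j (\<theta>' j) (t j)" z] by linarith
    then show "outcome G z = f (\<theta>(i := \<theta>i))"
      using yields \<theta>' t z unfolding yields_def \<theta>'_def[symmetric] by blast
  qed
  \<comment> \<open>If \<open>i\<close> also plays its default plan, the play is that of the game
    without leakage, which yields \<open>f\<close>. The plan ignores leaks, so its own probabilities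
    are the same for every observation set.\<close>
  also have "\<dots> = ex_ante_value i \<theta>i (- {i}) (default_plan i \<theta>i)"
  proof (rule ex_ante_value_implementing[OF default_plan_in_plans[OF \<theta>i], symmetric])
    fix \<theta> z
    assume \<theta>: "\<theta> \<in> PiE (- {i}) (payoff_types M)" and z: "terminal G z"
      and nz: "others_prob i \<theta> z * own_prob i (- {i}) (default_plan i \<theta>i) {0..<length z} z \<noteq> 0"
    define \<theta>' where "\<theta>' = \<theta>(i := \<theta>i)"
    have \<theta>': "\<theta>' \<in> payoff_profiles M" using \<theta> \<theta>i by (auto simp: payoff_profiles_def \<theta>'_def)
    have own: "own_prob i (observed_profile no_leakage (\<lambda>_. ()) i) (default_plan i \<theta>i) {0..<length z} z =
        own_prob i (- {i}) (default_plan i \<theta>i) {0..<length z} z"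
      by (rule own_prob_cong) (simp add: default_plan_def)
    have "reach_prob G (observed_profile no_leakage (\<lambda>_. ())) (\<lambda>j. lift_strategies S0 j (\<theta>' j) ()) z =
        others_prob i \<theta> z * own_prob i (observed_profile no_leakage (\<lambda>_. ()) i) (lift_strategies S0 i (\<theta>' i) ()) {0..<length z} z"
      by (rule reach_prob_eq) (simp add: \<theta>'_def lift_strategies_def)
    also have "lift_strategies S0 i (\<theta>' i) () = default_plan i \<theta>i"
      by (simp add: lift_strategies_def default_plan_def \<theta>'_def)
    finally have "reach_prob G (observed_profile no_leakage (\<lambda>_. ())) (\<lambda>j. lift_strategies S0 j (\<theta>' j) ()) z \<noteq> 0"
      using nz unfolding own by simp
    then have "reach_prob G (observed_profile no_leakage (\<lambda>_. ())) (\<lambda>j. lift_strategies S0 j (\<theta>' j) ()) z > 0"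
      using reach_prob_nonneg[of G "observed_profile no_leakage (\<lambda>_. ())" "\<lambda>j. lift_strategies S0 j (\<theta>' j) ()" z]
      by linarith
    moreover have "(\<lambda>_. ()) \<in> leakage_profiles no_leakage" "realizable no_leakage (\<lambda>_. ())"
      by (auto simp: leakage_profiles_def no_leakage_def realizable_def consistent_def possible_orders_def
          leakage_orders_def consistent_orders_def all_equal_def trans_def)
    ultimately show "outcome G z = f (\<theta>(i := \<theta>i))"
      using default_yields_if_default_part[OF yields rich part] \<theta>' z
      unfolding default_yields_def yields_def \<theta>'_def[symmetric] by blast
  qed
  finally show ?thesis .
qed

section \<open>An equilibrium that extends the default strategies\<close>

definition repaired_plan ::
  "'i \<Rightarrow> 'q \<Rightarrow> (('i, 'a) private_history \<Rightarrow> 'a pmf) \<Rightarrow> ('i, 'a) private_history \<Rightarrow> 'a pmf" where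
  "repaired_plan i \<theta>i \<rho> = (\<lambda>(h, l). if follows i \<theta>i h then S0 i \<theta>i h else \<rho> (h, l))"

lemma repaired_plan_in_plans:
  assumes "\<theta>i \<in> payoff_types M i" "\<rho> \<in> plans G i D"
  shows "repaired_plan i \<theta>i \<rho> \<in> plans G i D"
  using assms(2) default_plan_in_plans[OF assms(1), of D]
  by (auto simp: plans_def repaired_plan_def default_plan_def split: if_splits)

text \<open>Along \<open>z\<close> the two plans can differ only after \<open>i\<close> has left the
  support of the default plan. By \<open>foll\<close> this happens at \<open>h\<close> or later, so
  a zero factor has then already occurred in both products.\<close>

lemma plan_value_repaired_follows:
  assumes foll: "follows i \<theta>i h"
  shows "plan_value i \<theta>i D (repaired_plan i \<theta>i \<rho>) (h, l) = plan_value i \<theta>i D (default_plan i \<theta>i) (h, l)"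
  unfolding plan_value_def fst_conv
proof (intro sum.cong refl arg_cong2[where f = "(*)"] own_prob_eq_until_zero)
  fix z k
  assume z: "z \<in> {z. terminal G z \<and> passes i D (h, l) z}" and k: "k \<in> {length h..<length z}"
    and nz: "\<And>m. \<lbrakk>m \<in> {length h..<length z}; m < k; i \<in> movers G (take m z)\<rbrakk> \<Longrightarrow>
      pmf (default_plan i \<theta>i (take m z, (z ! m) |` D)) (the ((z ! m) i)) \<noteq> 0"
  have z': "take (length h) z = h" using z by (simp add: passes_def)
  have "follows i \<theta>i (take k z)"
    unfolding follows_def
  proof (intro allI impI)
    fix m assume m: "m < length (take k z)" "i \<in> movers G (take m (take k z))"
    have mk: "m < k" "m < length z" using m(1) by auto
    show "pmf (S0 i \<theta>i (take m (take k z))) (the ((take k z ! m) i)) \<noteq> 0"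
    proof (cases "m < length h")
      case True
      then have "take m h = take m z" "h ! m = z ! m"
        using z' by (metis min.absorb1 order_less_imp_le take_take, metis nth_take)
      then show ?thesis
        using foll True m mk by (auto simp: follows_def min_def)
    next
      case False
      then show ?thesis
        using nz[of m] m mk by (auto simp: default_plan_def min_def)
    qed
  qed
  then show "repaired_plan i \<theta>i \<rho> (take k z, (z ! k) |` D) = default_plan i \<theta>i (take k z, (z ! k) |` D)"
    by (simp add: repaired_plan_def default_plan_def)
qed simp

text \<open>A move outside the support stays in every extension of the history, so the repaired plan
  uses \<open>\<rho>\<close> throughout.\<close>

lemma plan_value_repaired_not_follows:
  assumes foll: "\<not> follows i \<theta>i h"
  shows "plan_value i \<theta>i D (repaired_plan i \<theta>i \<rho>) (h, l) = plan_value i \<theta>i D \<rho> (h, l)"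
  unfolding plan_value_def fst_conv
proof (intro sum.cong refl arg_cong2[where f = "(*)"] own_prob_cong)
  fix z k
  assume z: "z \<in> {z. terminal G z \<and> passes i D (h, l) z}" and k: "k \<in> {length h..<length z}"
  have z': "take (length h) z = h" using z by (simp add: passes_def)
  obtain m where m: "m < length h" "i \<in> movers G (take m h)" "pmf (S0 i \<theta>i (take m h)) (the ((h ! m) i)) = 0"
    using foll by (auto simp: follows_def)
  have "take m h = take m z" "h ! m = z ! m"
    using z' m(1) by (metis min.absorb1 order_less_imp_le take_take, metis nth_take)
  then have "\<not> follows i \<theta>i (take k z)"
    using m k unfolding follows_def by (auto intro!: exI[of _ m] simp: min_def)
  then show "repaired_plan i \<theta>i \<rho> (take k z, (z ! k) |` D) = \<rho> (take k z, (z ! k) |` D)"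
    by (simp add: repaired_plan_def)
qed

text \<open>After a deviation of \<open>i\<close>, its plan is optimised against default play of the
  others. What the others would do after deviations of their own never enters the values of
  \<open>i\<close>, so the plan of each player after its own deviations can be chosen
  separately.\<close>

lemma PBE_extending_default_plan:
  fixes T :: "('i, 't) type_space"
  assumes pruned: "pruned M G S0" and feas: "feasible T"
    and opt: "\<And>i \<theta>i \<tau>. \<lbrakk>\<theta>i \<in> payoff_types M i; \<tau> \<in> plans G i (- {i})\<rbrakk> \<Longrightarrow>
      ex_ante_value i \<theta>i (- {i}) \<tau> \<le> ex_ante_value i \<theta>i (- {i}) (default_plan i \<theta>i)"
  obtains S :: "('i, 'q, 't, 'a) strategies" and \<mu> where "PBE M G T S \<mu>"
    "\<And>i \<theta>i ti h l. follows i \<theta>i h \<Longrightarrow> S i \<theta>i ti (h, l) = S0 i \<theta>i h"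
proof -
  define \<rho> where "\<rho> i \<theta>i D = (SOME \<sigma>. \<sigma> \<in> plans G i D \<and> (\<forall>hi\<in>private_histories G i D. \<forall>\<tau>\<in>plans G i D.
      plan_value i \<theta>i D \<tau> hi \<le> plan_value i \<theta>i D \<sigma> hi))" for i \<theta>i D
  have \<rho>: "\<rho> i \<theta>i D \<in> plans G i D \<and> (\<forall>hi\<in>private_histories G i D. \<forall>\<tau>\<in>plans G i D.
      plan_value i \<theta>i D \<tau> hi \<le> plan_value i \<theta>i D (\<rho> i \<theta>i D) hi)" if "\<theta>i \<in> payoff_types M i" for i \<theta>i D
  proof -
    have "\<exists>\<sigma>. \<sigma> \<in> plans G i D \<and> (\<forall>hi\<in>private_histories G i D. \<forall>\<tau>\<in>plans G i D.
        plan_value i \<theta>i D \<tau> hi \<le> plan_value i \<theta>i D \<sigma> hi)"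
      by (rule optimal_plan_exists[OF that, of D]) blast
    then show ?thesis unfolding \<rho>_def by (rule someI_ex)
  qed
  define S :: "('i, 'q, 't, 'a) strategies"
    where "S i \<theta>i ti = repaired_plan i \<theta>i (\<rho> i \<theta>i (observed T i ti))" for i \<theta>i ti
  have foll: "S i \<theta>i ti (h, l) = S0 i \<theta>i h" if "follows i \<theta>i h" for i \<theta>i ti h l
    using that by (simp add: S_def repaired_plan_def)
  have comp: "compliant T S i ti" for i ti
    by (simp add: compliant_def foll)
  define \<mu> where "\<mu> i hi ti = (SOME p. set_pmf p \<subseteq> set_pmf (initial_belief M T i ti) \<and>
      (\<forall>\<mu>. \<mu> i hi ti = p \<longrightarrow> bayes_consistent M G T S \<mu> i ti hi))" for i hi ti
  have \<mu>: "set_pmf (\<mu> i hi ti) \<subseteq> set_pmf (initial_belief M T i ti) \<and>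
      (\<forall>\<mu>'. \<mu>' i hi ti = \<mu> i hi ti \<longrightarrow> bayes_consistent M G T S \<mu>' i ti hi)"
    if ti: "ti \<in> leakage_types T i" and hi: "hi \<in> private_histories G i (observed T i ti)" for i hi ti
  proof -
    obtain p where "\<And>\<mu>. \<mu> i hi ti = p \<Longrightarrow> bayes_consistent M G T S \<mu> i ti hi"
        "set_pmf p \<subseteq> set_pmf (initial_belief M T i ti)"
      using Bayes_belief_exists[OF comp finite_type_belief[OF feas ti] pruned hi] by blast
    then have "\<exists>p. set_pmf p \<subseteq> set_pmf (initial_belief M T i ti) \<and>
        (\<forall>\<mu>. \<mu> i hi ti = p \<longrightarrow> bayes_consistent M G T S \<mu> i ti hi)"
      by blast
    then show ?thesis unfolding \<mu>_def by (rule someI_ex)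
  qed
  have "PBE M G T S \<mu>"
    unfolding PBE_def
  proof (intro allI ballI conjI)
    fix i ti hi
    assume ti: "ti \<in> leakage_types T i" and hi: "hi \<in> private_histories G i (observed T i ti)"
    show bayes: "bayes_consistent M G T S \<mu> i ti hi"
      using \<mu> ti hi by blast
    \<comment> \<open>Feasibility makes every profile in the support of a type's belief realizable
      together with that type, and the support of \<open>\<mu>\<close> lies within that of the
      initial belief.\<close>
    have "set_pmf (initial_belief M T i ti) \<subseteq> PiE (- {i}) (payoff_types M) \<times>
        {t \<in> PiE (- {i}) (leakage_types T). realizable T (t(i := ti))}"
    proof -
      have "t \<in> PiE (- {i}) (leakage_types T) \<and> realizable T (t(i := ti))" if "(r, t) \<in> set_pmf (type_belief T i ti)" for r t
        using feas ti that unfolding feasible_def realizable_def by blast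
      then show ?thesis unfolding set_initial_belief by fastforce
    qed
    then show "set_pmf (\<mu> i hi ti) \<subseteq> PiE (- {i}) (payoff_types M) \<times>
        {t \<in> PiE (- {i}) (leakage_types T). realizable T (t(i := ti))}"
      using \<mu> ti hi by blast
    fix \<theta>i assume \<theta>i: "\<theta>i \<in> payoff_types M i"
    define D where "D = observed T i ti"
    have i: "i \<notin> D" by (simp add: D_def observed_irrefl)
    obtain h l where hl: "hi = (h, l)" by force
    have "plan_value i \<theta>i D \<tau> hi \<le> plan_value i \<theta>i D (S i \<theta>i ti) hi" if \<tau>: "\<tau> \<in> plans G i D" for \<tau>
    proof (cases "follows i \<theta>i h")
      case True
      then show ?thesis
        unfolding hl S_def plan_value_repaired_follows[OF True]
        using default_plan_optimal[OF \<theta>i opt[OF \<theta>i] _ True i \<tau>] hi by (simp add: D_def hl)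
    next
      case False
      then show ?thesis
        unfolding hl S_def plan_value_repaired_not_follows[OF False]
        using \<rho>[OF \<theta>i, of D] hi \<tau> by (simp add: D_def hl)
    qed
    moreover have "total_likelihood i D hi > 0"
      unfolding hl by (rule total_likelihood_pos[OF pruned _ i]) (use hi in \<open>simp add: D_def hl\<close>)
    moreover have "S i \<theta>i ti \<in> plans G i D"
      unfolding S_def D_def by (rule repaired_plan_in_plans[OF \<theta>i]) (use \<rho>[OF \<theta>i] in blast)
    ultimately show "is_arg_max (expected_utility M G T S \<mu> i \<theta>i ti hi)
        (\<lambda>\<sigma>i. \<sigma>i \<in> plans G i (observed T i ti)) (S i \<theta>i ti)"
      unfolding is_arg_max_def expected_utility_eq[OF comp finite_type_belief[OF feas ti] pruned hi bayes]
        D_def[symmetric]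
      by (auto simp: not_less divide_le_cancel)
  qed
  then show thesis
    using that foll by blast
qed

text \<open>\<open>agree\<close> speaks only of private histories on the default path, so play has
  to be kept on that path. This goes stage by stage: a move with positive probability under
  \<open>S\<close> is a default move once the private history of its player is known to be on the
  path. Terminal histories reached under \<open>S\<close> are then reached in the default game as
  well.\<close>

lemma outcome_if_agrees_on_path:
  assumes yields: "default_yields M G S0 f"
    and PBE: "PBE M G T S \<mu>"
    and agree: "\<And>\<theta> t i h l. \<lbrakk>\<theta> \<in> payoff_profiles M; t \<in> leakage_profiles T;
        (h, l) \<in> private_histories G i (observed T i (t i));
        private_on_path G S0 \<theta> i (observed T i (t i)) (h, l); i \<in> movers G h\<rbrakk> \<Longrightarrow>
      S i (\<theta> i) (t i) (h, l) = S0 i (\<theta> i) h"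
  shows "yields M G T S f"
  unfolding yields_def
proof (intro ballI impI allI; elim conjE)
  fix \<theta> t z
  assume \<theta>: "\<theta> \<in> payoff_profiles M" and t: "t \<in> leakage_profiles T" and real: "realizable T t"
    and z: "terminal G z" and pos: "0 < reach_prob G (observed_profile T t) (\<lambda>j. S j (\<theta> j) (t j)) z"
  obtain r where r: "consistent T r t" using real by (auto simp: realizable_def)
  then have order: "r \<in> leakage_orders" by (simp add: consistent_def)
  have \<theta>j: "\<theta> j \<in> payoff_types M j" for j using \<theta> by (simp add: payoff_profiles_def)
  have nz: "pmf (S j (\<theta> j) (t j) (take k z, (z ! k) |` observed T j (t j))) (the ((z ! k) j)) \<noteq> 0"
    if "k < length z" "j \<in> movers G (take k z)" for k j
  proof -
    have "reach_prob G (observed_profile T t) (\<lambda>j. S j (\<theta> j) (t j)) z \<noteq> 0" using pos by simp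
    then show ?thesis
      using that by (simp add: reach_prob_def stage_prob_def observed_profile_def)
  qed
  have "\<forall>j. follows j (\<theta> j) (take k z)" if "k \<le> length z" for k
    using that
  proof (induction k)
    case 0
    then show ?case by (simp add: follows_def)
  next
    case (Suc k)
    define h where "h = take k z"
    define a where "a = z ! k"
    have h: "h @ [a] \<in> histories G" "take (Suc k) z = h @ [a]"
      using take_snoc_history[OF terminal_history[OF z], of k] Suc.prems
      by (auto simp: h_def a_def take_Suc_conv_app_nth)
    have foll: "follows j (\<theta> j) h" for j using Suc by (simp add: h_def)
    have a: "a \<in> stage_maps (movers G h) (\<lambda>i. actions G i h)"
      using snoc_history_iff[OF h(1)] h(1) by blast
    have follows_snoc: "follows j (\<theta> j) (h @ [b]) \<longleftrightarrow> (j \<in> movers G h \<longrightarrow> pmf (S0 j (\<theta> j) h) (the (b j)) \<noteq> 0)" for j b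
      using foll[of j] by (auto simp: follows_def nth_append less_Suc_eq)
    text \<open>Within the stage, the claim is propagated from the slower players to the faster ones.\<close>
    have "pmf (S0 j (\<theta> j) h) (the (a j)) \<noteq> 0" if "j \<in> movers G h" for j
      using that
    proof (induction "card (slower r j)" arbitrary: j rule: less_induct)
      case less
      define D where "D = observed T j (t j)"
      have D: "D = slower r j" using observed_eq_slower[OF r] by (simp add: D_def)
      have slower_nz: "pmf (S0 j' (\<theta> j') h) (the (a j')) \<noteq> 0" if "j' \<in> D" "j' \<in> movers G h" for j'
        using less.hyps[OF psubset_card_mono[OF finite slower_psubset[OF order]]] that by (simp add: D)
      \<comment> \<open>An auxiliary stage: movers in \<open>D\<close> act as in \<open>a\<close>,
        all other movers take some action in the support of their default strategy. It stays on the
        default path and leaks the same actions to \<open>j\<close>, which is what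
        \<open>private_on_path\<close> asks for.\<close>
      define b where "b j' = (if j' \<in> movers G h - D then Some (SOME x. x \<in> set_pmf (S0 j' (\<theta> j') h)) else a j')" for j'
      have some: "(SOME x. x \<in> set_pmf (S0 j' (\<theta> j') h)) \<in> set_pmf (S0 j' (\<theta> j') h)" for j'
        by (rule someI_ex) (use set_pmf_not_empty[of "S0 j' (\<theta> j') h"] in blast)
      have "b \<in> stage_maps (movers G h) (\<lambda>i. actions G i h)"
        unfolding stage_maps_def
      proof (intro CollectI conjI ballI)
        show "dom b = movers G h"
          using a by (auto simp: stage_maps_def b_def dom_def split: if_splits)
        show "the (b k) \<in> actions G k h" if "k \<in> movers G h" for k
          using a some[of k] S0_actions[OF \<theta>j h(1) that] that by (auto simp: stage_maps_def b_def)
      qed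
      then have b: "h @ [b] \<in> histories G" using snoc_history_iff[OF h(1)] by blast
      have "on_path G S0 \<theta> (h @ [b])"
        using b slower_nz some by (auto simp: on_path_iff follows_snoc b_def set_pmf_iff)
      moreover have ab: "a |` leaked G j D h = b |` leaked G j D h"
        using less.prems by (auto simp: leaked_def restrict_map_def b_def fun_eq_iff)
      ultimately have "private_on_path G S0 \<theta> j D (h, a |` leaked G j D h)"
        by (auto simp: private_on_path_def)
      moreover have "(h, a |` leaked G j D h) \<in> private_histories G j D"
        using h(1) by (auto simp: mem_private_histories)
      ultimately have "S j (\<theta> j) (t j) (h, a |` leaked G j D h) = S0 j (\<theta> j) h"
        using agree[OF \<theta> t] less.prems by (simp add: D_def)
      \<comment> \<open>\<open>z\<close> is reached under \<open>S\<close>, so the factor of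
        \<open>j\<close> at stage \<open>k\<close> is nonzero, and it has just been identified with
        the default one.\<close>
      then show ?case
        using nz[of k j] less.prems Suc.prems by (simp add: h_def a_def D_def leaked_def)
    qed
    then show ?case
      by (simp add: h(2) follows_snoc)
  qed
  from this[of "length z"] have "\<forall>j. follows j (\<theta> j) z" by simp
  then have "0 < reach_prob G (observed_profile no_leakage (\<lambda>_. ())) (\<lambda>j. lift_strategies S0 j (\<theta> j) ()) z"
    by (simp add: lift_strategies_def reach_pos_iff_follows)
  moreover have "(\<lambda>_. ()) \<in> leakage_profiles no_leakage" "realizable no_leakage (\<lambda>_. ())"
    by (auto simp: leakage_profiles_def no_leakage_def realizable_def consistent_def possible_orders_def
        leakage_orders_def consistent_orders_def all_equal_def trans_def)
  ultimately show "outcome G z = f \<theta>"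
    using yields \<theta> z unfolding default_yields_def yields_def by blast
qed

section \<open>The two directions of the equivalence\<close>

lemma implements_if_leakage_proof:
  assumes "leakage_proof M G S0 \<mu>0" "default_yields M G S0 f"
  shows "implements M G f"
  unfolding implements_def
proof (intro allI impI)
  fix T :: "('i, nat) type_space"
  assume "feasible T"
  then obtain S \<mu> where PBE: "PBE M G T S \<mu>"
    and agree: "\<forall>\<theta> \<in> payoff_profiles M. \<forall>t \<in> leakage_profiles T. \<forall>i.
              \<forall>(h, l) \<in> private_histories G i (observed T i (t i)).
                private_on_path G S0 \<theta> i (observed T i (t i)) (h, l) \<and> i \<in> movers G h \<longrightarrow>
                S i (\<theta> i) (t i) (h, l) = S0 i (\<theta> i) h"
    using assms(1) unfolding leakage_proof_def by blast
  have "yields M G T S f"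
    by (rule outcome_if_agrees_on_path[OF assms(2) PBE]) (use agree in fast)
  then show "\<exists>S \<mu>. PBE M G T S \<mu> \<and> yields M G T S f"
    using PBE by blast
qed

lemma leakage_proof_if_ex_ante_optimal:
  assumes default: "default_PBE M G S0 \<mu>0" and pruned: "pruned M G S0"
    and opt: "\<And>i \<theta>i \<tau>. \<lbrakk>\<theta>i \<in> payoff_types M i; \<tau> \<in> plans G i (- {i})\<rbrakk> \<Longrightarrow>
      ex_ante_value i \<theta>i (- {i}) \<tau> \<le> ex_ante_value i \<theta>i (- {i}) (default_plan i \<theta>i)"
  shows "leakage_proof M G S0 \<mu>0"
  unfolding leakage_proof_def
proof (intro conjI allI impI default)
  fix T :: "('i, nat) type_space"
  assume "feasible T"
  then obtain S :: "('i, 'q, nat, 'a) strategies" and \<mu> where PBE: "PBE M G T S \<mu>"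
    and foll: "\<And>i \<theta>i ti h l. follows i \<theta>i h \<Longrightarrow> S i \<theta>i ti (h, l) = S0 i \<theta>i h"
    using PBE_extending_default_plan[OF pruned _ opt] by blast
  have "S i (\<theta> i) (t i) (h, l) = S0 i (\<theta> i) h"
    if on_path: "private_on_path G S0 \<theta> i (observed T i (t i)) (h, l)" for \<theta> t i h l
  proof (rule foll)
    obtain a where "follows i (\<theta> i) (h @ [a])"
      using on_path by (auto simp: private_on_path_def on_path_iff)
    then show "follows i (\<theta> i) h"
      unfolding follows_def
    proof (intro allI impI, goal_cases)
      case (1 k)
      from 1(1)[rule_format, of k] 1(2,3) show ?case by (simp add: nth_append)
    qed
  qed
  then show "\<exists>S \<mu>. PBE M G T S \<mu> \<and>
           (\<forall>\<theta> \<in> payoff_profiles M. \<forall>t \<in> leakage_profiles T. \<forall>i.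
              \<forall>(h, l) \<in> private_histories G i (observed T i (t i)).
                private_on_path G S0 \<theta> i (observed T i (t i)) (h, l) \<and> i \<in> movers G h \<longrightarrow>
                S i (\<theta> i) (t i) (h, l) = S0 i (\<theta> i) h)"
    using PBE by blast
qed

end

theorem theorem1:
  fixes M :: "('i::finite, 'q, 'x) payoffs"
    and G :: "('i, 'a, 'x) game"
    and f :: "('i \<Rightarrow> 'q) \<Rightarrow> 'x"
    and S0 :: "('i, 'q, 'a) default_strategies"
    and \<mu>0 :: "('i, 'q, 'a) default_beliefs"
  assumes "valid_payoffs M"
    and "multistage_game M G"
    and "f \<in> payoff_profiles M \<rightarrow> outcomes M"
    and "default_PBE M G S0 \<mu>0"
    and "implements M G f \<Longrightarrow>
           \<exists>(T :: ('i, nat) type_space) S \<mu>.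
             feasible T \<and> PBE M G T S \<mu> \<and> yields M G T S f \<and> default_part M G T S S0"
    and "pruned M G S0"
  shows "implements M G f \<longleftrightarrow>
         (\<exists>S0' \<mu>0'. leakage_proof M G S0' \<mu>0' \<and> default_yields M G S0' f)"
proof
  assume "implements M G f"
  then obtain T :: "('i, nat) type_space" and S \<mu> where T: "feasible T" "PBE M G T S \<mu>" "yields M G T S f"
    and "default_part M G T S S0"
    using assms(5) by blast
  then obtain t0 where t0: "minimally_rich T t0"
    and part: "\<And>i \<theta>i h. \<lbrakk>\<theta>i \<in> payoff_types M i; h \<in> histories G; \<not> terminal G h; i \<in> movers G h\<rbrakk> \<Longrightarrow>
      S0 i \<theta>i h = S i \<theta>i (t0 i) (h, Map.empty)"
    unfolding default_part_def by blast
  interpret default_play M G S0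
    using default_play_if_default_PBE[OF assms(1,2,4)] .
  \<comment> \<open>The default strategies themselves are the witness, since they are the
    zero-profile part of the equilibrium at hand.\<close>
  have "leakage_proof M G S0 \<mu>0"
    by (rule leakage_proof_if_ex_ante_optimal[OF assms(4,6)
          default_plan_ex_ante_optimal[OF assms(6) T t0 part]])
  moreover have "default_yields M G S0 f"
    by (rule default_yields_if_default_part[OF T(3) t0 part])
  ultimately show "\<exists>S0' \<mu>0'. leakage_proof M G S0' \<mu>0' \<and> default_yields M G S0' f"
    by blast
next
  assume "\<exists>S0' \<mu>0'. leakage_proof M G S0' \<mu>0' \<and> default_yields M G S0' f"
  then obtain S0' \<mu>0' where lp: "leakage_proof M G S0' \<mu>0'" "default_yields M G S0' f"
    by blast
  \<comment> \<open>The given equilibrium may differ from \<open>S0\<close>; being a default PBE is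
    part of \<open>leakage_proof\<close>, so the locale applies to it.\<close>
  interpret default_play M G S0'
    using default_play_if_default_PBE[OF assms(1,2)] lp(1) unfolding leakage_proof_def by blast
  show "implements M G f"
    using implements_if_leakage_proof[OF lp] .
qed

end
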